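(* Let $\mathbb{F}$ be a finite field. Given $k,m,r\in\mathbb{N}$ there is $n\in\mathbb{N}$ such that for every map $c:M_{n,k}^k(\mathbb{F})\to\{0,1,\dots,r-1\}$ there is $R\in\mathcal{E}_{n,m}(\mathbb{F})$ such that $\tau$ is a factor of $c$ in $R\cdot M_{m,k}^k(\mathbb{F})=\{R\cdot A: A\in M_{m,k}^k(\mathbb{F})\}$; that is, there is $\widetilde{c}:\mathrm{GL}(\mathbb{F}^k)\to\{0,1,\dots,r-1\}$ such that $c(R\cdot A)=\widetilde{c}(\tau(R\cdot A))$ for every $A\in M_{m,k}^k(\mathbb{F})$.
   Context: $M_{n,k}^k(\mathbb{F})$ is the set of $n\times k$ matrices of rank $k$ over $\mathbb{F}$. Rows and columns are indexed from $0$ and $u_i$ denotes the $i$-th unit vector; $\langle\cdot\rangle$ denotes linear span. A $p\times q$ matrix $A$ of rank $p_0$ is in reduced row echelon form (RREF) if there is a strictly increasing sequence $(j_i)_{i<p_0}$ of integers $<q$ such that $A\cdot u_{j_i}=u_i$ and $\langle A\cdot u_j\rangle_{j<j_i}=\langle u_l\rangle_{l<i}$ for every $i<p_0$. A matrix is in reduced column echelon form (RCEF) if its transpose is in RREF. $\mathcal{E}_{n,m}(\mathbb{F})$ is the set of $n\times m$ matrices of rank $m$ over $\mathbb{F}$ in RCEF. For a matrix $A$ with $k$ columns and rank $k$, $\tau(A)$ is the unique invertible $k\times k$ matrix such that $A\cdot\tau(A)$ is in RCEF. A map $\pi:X\to K$ is a factor of $c:X\to r$ in $Y\subseteq X$ if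 there is $\widetilde c:K\to r$ with $c(y)=\widetilde c(\pi(y))$ for all $y\in Y$. *)

theory Defs
  imports "Jordan_Normal_Form.DL_Rank" "HOL-Library.FuncSet"
begin

definition rank_mats :: "nat \<Rightarrow> nat \<Rightarrow> nat \<Rightarrow> 'a::field mat set" where
  "rank_mats n k l = {A \<in> carrier_mat n k. vec_space.rank n A = l}"

abbreviation vec_span :: "nat \<Rightarrow> 'a::field vec set \<Rightarrow> 'a vec set" where
  "vec_span p S \<equiv> LinearCombinations.module.span class_ring (module_vec TYPE('a) p) S"

definition is_rref :: "'a::field mat \<Rightarrow> bool" where
  "is_rref A \<longleftrightarrow>
    (let p = dim_row A; q = dim_col A; p0 = vec_space.rank p A in
      \<exists>j :: nat \<Rightarrow> nat. strict_mono_on {..<p0} j \<and>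
        (\<forall>i<p0. j i < q \<and>
          A *\<^sub>v unit_vec q (j i) = unit_vec p i \<and>
          vec_span p ((\<lambda>j'. A *\<^sub>v unit_vec q j') ` {..<j i}) = vec_span p (unit_vec p ` {..<i})))"

definition is_rcef :: "'a::field mat \<Rightarrow> bool" where
  "is_rcef A \<longleftrightarrow> is_rref (transpose_mat A)"

definition rcef_mats :: "nat \<Rightarrow> nat \<Rightarrow> 'a::field mat set" where
  "rcef_mats n m = {A \<in> rank_mats n m m. is_rcef A}"

definition GL_mats :: "nat \<Rightarrow> 'a::field mat set" where
  "GL_mats k = {T \<in> carrier_mat k k. invertible_mat T}"

(* Meaningful only for A of full column rank, where the matrix T exists and is unique. *)
definition tau :: "'a::field mat \<Rightarrow> 'a mat" where
  "tau A = (THE T. T \<in> GL_mats (dim_col A) \<and> is_rcef (A * T))"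

(* The map f : X \<rightarrow> K is a factor of the colouring c : X \<rightarrow> {0,...,r-1} in Y \<subseteq> X. *)
definition is_factor_in ::
    "'x set \<Rightarrow> 'k set \<Rightarrow> nat \<Rightarrow> ('x \<Rightarrow> 'k) \<Rightarrow> ('x \<Rightarrow> nat) \<Rightarrow> 'x set \<Rightarrow> bool" where
  "is_factor_in X K r f c Y \<longleftrightarrow>
    f \<in> X \<rightarrow> K \<and> c \<in> X \<rightarrow> {..<r} \<and> Y \<subseteq> X \<and>
    (\<exists>c' \<in> K \<rightarrow> {..<r}. \<forall>y\<in>Y. c y = c' (f y))"

end

theory Submission
  imports Defs
begin

text \<open>
A matrix \<open>A\<close> of full column rank factors uniquely as \<open>A = B * G\<close> with \<open>B\<close> in reduced column echelon
form and \<open>G\<close> invertible, and \<open>tau A\<close> is the inverse of \<open>G\<close>. Multiplication from the left by an echelon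
matrix \<open>R\<close> keeps \<open>R * B\<close> in echelon form, so \<open>tau (R * A) = tau A\<close> (\<open>tau_echelon_mult\<close>). As
there are finitely many \<open>G\<close>, one may colour \<open>B\<close> by the whole function \<open>G \<mapsto> c (B * G)\<close>, and it suffices
to find \<open>R\<close> such that \<open>R * B\<close> has the same colour for all echelon matrices \<open>B\<close> of a given size.
This is the Ramsey theorem of Graham, Leeb and Rothschild for subspaces of a finite vector space,
\<open>echelon_ramsey\<close>.

It is proved by induction on the number of columns. First, the Hales--Jewett theorem, with
matrices as letters, gives an affine Ramsey theorem (\<open>affine_ramsey\<close>). Suppose that the rows of a prefix
\<open>P\<close> of \<open>B\<close> span everything. Then the rows below are \<open>w * P\<close> for some matrix \<open>w\<close>, and the affine theorem
makes the colour independent of \<open>w\<close>, simultaneously for all \<open>P\<close> (\<open>block_ramsey\<close>). Since the rows down to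
the last pivot span everything, the colour then depends only on the rows above the last pivot.
These rows form an echelon matrix with one column less, and the induction hypothesis, applied to
one position of the last pivot after another, removes the dependence on them
(\<open>last_pivot_ramsey\<close>). The position of the last pivot is all that is left, and it is removed by the
pigeonhole principle.
\<close>

section \<open>Words and the Hales--Jewett theorem\<close>

definition words :: "'b set \<Rightarrow> nat \<Rightarrow> 'b list set" where
  "words A N = {w. length w = N \<and> set w \<subseteq> A}"

text \<open>A combinatorial line is coded by its template: the letter \<open>None\<close> marks the active
positions, which all carry the same moving letter.\<close>

definition is_line :: "'b set \<Rightarrow> nat \<Rightarrow> 'b option list \<Rightarrow> bool" where
  "is_line A N t \<longleftrightarrow> length t = N \<and> None \<in> set t \<and> set t \<subseteq> insert None (Some ` A)"

definition fill :: "'b option list \<Rightarrow> 'b \<Rightarrow> 'b list" where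
  "fill t a = map (\<lambda>x. case x of None \<Rightarrow> a | Some b \<Rightarrow> b) t"

lemma fill_append [simp]: "fill (s @ t) a = fill s a @ fill t a"
  by (simp add: fill_def)

lemma fill_map_Some [simp]: "fill (map Some w) a = w"
  by (simp add: fill_def comp_def)

lemma fill_in_words: "is_line A N t \<Longrightarrow> a \<in> A \<Longrightarrow> fill t a \<in> words A N"
  unfolding is_line_def words_def fill_def by (auto split: option.splits)

lemma words_append: "v \<in> words A M \<Longrightarrow> w \<in> words A N \<Longrightarrow> v @ w \<in> words A (M + N)"
  unfolding words_def by auto

lemma words_mono: "A \<subseteq> B \<Longrightarrow> words A N \<subseteq> words B N"
  unfolding words_def by auto

lemma finite_words: "finite A \<Longrightarrow> finite (words A N)"
  unfolding words_def using finite_lists_length_eq[of A N] by (simp add: conj_commute)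

lemma is_line_append: "is_line A M s \<Longrightarrow> is_line A N t \<Longrightarrow> is_line A (M + N) (s @ t)"
  unfolding is_line_def by auto

lemma is_line_append_word: "is_line A M s \<Longrightarrow> w \<in> words A N \<Longrightarrow> is_line A (M + N) (s @ map Some w)"
  unfolding is_line_def words_def by auto

lemma is_line_word_append: "w \<in> words A M \<Longrightarrow> is_line A N t \<Longrightarrow> is_line A (M + N) (map Some w @ t)"
  unfolding is_line_def words_def by auto

lemma is_line_mono: "A \<subseteq> B \<Longrightarrow> is_line A N t \<Longrightarrow> is_line B N t"
  unfolding is_line_def by (meson dual_order.trans image_mono insert_mono)

definition hales_jewett_for :: "'b set \<Rightarrow> nat \<Rightarrow> 'c set \<Rightarrow> bool" where
  "hales_jewett_for A N C \<longleftrightarrow> (\<forall>c \<in> words A N \<rightarrow> C.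
     \<exists>t. is_line A N t \<and> (\<forall>a\<in>A. \<forall>b\<in>A. c (fill t a) = c (fill t b)))"

text \<open>Product arguments recolour words by functions, so colours from an arbitrary finite set are
needed; numbering the colours reduces them to natural numbers.\<close>

lemma hales_jewett_for_finite_colours:
  assumes "\<forall>r. \<exists>N. hales_jewett_for A N {..<r::nat}" and C: "finite C"
  shows "\<exists>N. hales_jewett_for A N C"
proof -
  obtain h :: "_ \<Rightarrow> nat" and n where h: "h ` C = {i. i < n}" "inj_on h C"
    using finite_imp_inj_to_nat_seg[OF C] by metis
  obtain N where N: "hales_jewett_for A N {..<n}" using assms(1) by blast
  have "hales_jewett_for A N C"
    unfolding hales_jewett_for_def
  proof
    fix c assume c: "c \<in> words A N \<rightarrow> C"
    have "(\<lambda>w. h (c w)) \<in> words A N \<rightarrow> {..<n}"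
    proof
      fix w assume "w \<in> words A N"
      then have "h (c w) \<in> h ` C" using c by blast
      then show "h (c w) \<in> {..<n}" using h(1) by simp
    qed
    then obtain t where t: "is_line A N t" "\<forall>a\<in>A. \<forall>b\<in>A. h (c (fill t a)) = h (c (fill t b))"
      using N unfolding hales_jewett_for_def by meson
    have "c (fill t a) = c (fill t b)" if "a \<in> A" "b \<in> A" for a b
      using t(2) that fill_in_words[OF t(1)] c h(2) by (meson PiE funcset_mem inj_onD)
    then show "\<exists>t. is_line A N t \<and> (\<forall>a\<in>A. \<forall>b\<in>A. c (fill t a) = c (fill t b))"
      using t(1) by blast
  qed
  then show ?thesis ..
qed

text \<open>Lines that are monochromatic over the smaller alphabet \<open>A\<close>, one for each colour in \<open>K\<close>, and
that all pass through the word \<open>f\<close> once the new letter \<open>b\<close> is filled in. If \<open>K\<close> exhausted the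
colours, \<open>f\<close> would have no colour left.\<close>

definition focused :: "'b set \<Rightarrow> 'b \<Rightarrow> nat \<Rightarrow> ('b list \<Rightarrow> 'c) \<Rightarrow> 'c set \<Rightarrow> 'b list \<Rightarrow> bool" where
  "focused A b N c K f \<longleftrightarrow> f \<in> words (insert b A) N \<and> c f \<notin> K \<and>
     (\<forall>x\<in>K. \<exists>t. is_line (insert b A) N t \<and> fill t b = f \<and> (\<forall>a\<in>A. c (fill t a) = x))"

text \<open>Induction on the alphabet with colour focusing. For a new letter \<open>b\<close>, one shows by an inner
induction that in long enough words there is a monochromatic line or a focused family with \<open>s\<close>
colours. To pass from \<open>s\<close> to \<open>s + 1\<close>, words are split as \<open>v @ w\<close>; the theorem for \<open>A\<close>, applied to
the colouring that sends \<open>v\<close> to the function \<open>w \<mapsto> c (v @ w)\<close>, yields a template \<open>T\<close> along which the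
colour does not see the letter of \<open>A\<close> filled into \<open>T\<close>. Prefixing \<open>T\<close> to the lines of a focused
family keeps their colours, and \<open>T\<close> followed by the old focus is a line of a further colour; all
these lines meet in one new focus. A family with \<open>r\<close> colours is impossible, so a monochromatic line
must have occurred.\<close>

lemma hales_jewett_nat_colours:
  assumes "finite A"
  shows "\<forall>r. \<exists>N. hales_jewett_for A N {..<r::nat}"
  using assms
proof (induction A rule: finite_induct)
  case empty
  have "is_line {} 1 [None]" by (simp add: is_line_def)
  then show ?case unfolding hales_jewett_for_def by blast
next
  case (insert b A)
  let ?B = "insert b A"
  show ?case
  proof (cases "A = {}")
    case True
    have "is_line ?B 1 [None]" by (simp add: is_line_def)
    then show ?thesis unfolding hales_jewett_for_def using True by blast
  next
    case False
    then obtain a0 where a0: "a0 \<in> A" by blast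
    show ?thesis
    proof
      fix r :: nat
      let ?mono = "\<lambda>N c. \<exists>t. is_line ?B N t \<and> (\<forall>a\<in>?B. \<forall>a'\<in>?B. c (fill t a) = c (fill t a'))"
      have foc: "\<exists>N. \<forall>c \<in> words ?B N \<rightarrow> {..<r}. ?mono N c \<or>
          (\<exists>K f. K \<subseteq> {..<r} \<and> card K = s \<and> focused A b N c K f)" for s
      proof (induction s)
        case 0
        have "focused A b 0 c {} []" for c :: "'a list \<Rightarrow> nat"
          by (simp add: focused_def words_def)
        then show ?case by (intro exI[of _ 0]) (metis card.empty empty_subsetI)
      next
        case (Suc s)
        then obtain N where N: "\<And>c. c \<in> words ?B N \<rightarrow> {..<r} \<Longrightarrow> ?mono N c \<or>
          (\<exists>K f. K \<subseteq> {..<r} \<and> card K = s \<and> focused A b N c K f)" by blast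
        let ?C = "words ?B N \<rightarrow>\<^sub>E {..<r}"
        have "finite ?C" using finite_words[of ?B N] insert.hyps(1) by (intro finite_PiE) auto
        from hales_jewett_for_finite_colours[OF insert.IH this]
        obtain M where M: "hales_jewett_for A M ?C" by blast
        have "?mono (M + N) c \<or>
            (\<exists>K f. K \<subseteq> {..<r} \<and> card K = Suc s \<and> focused A b (M + N) c K f)"
          if c: "c \<in> words ?B (M + N) \<rightarrow> {..<r}" for c
        proof -
          have AB: "words A M \<subseteq> words ?B M" by (rule words_mono) auto
          have cr: "c (v @ w) < r" if "v \<in> words ?B M" "w \<in> words ?B N" for v w
            using c words_append[OF that] by auto
          have "(\<lambda>v. restrict (\<lambda>w. c (v @ w)) (words ?B N)) \<in> words A M \<rightarrow> ?C"
            using cr AB by (fastforce intro: restrict_PiE_iff[THEN iffD2])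
          then obtain T where T: "is_line A M T" and
            Tc: "\<forall>a\<in>A. \<forall>a'\<in>A. restrict (\<lambda>w. c (fill T a @ w)) (words ?B N)
              = restrict (\<lambda>w. c (fill T a' @ w)) (words ?B N)"
            using M unfolding hales_jewett_for_def by meson
          have TB: "is_line ?B M T" using is_line_mono[OF _ T] by auto
          define d where "d w = c (fill T a0 @ w)" for w
          have d: "c (fill T a @ w) = d w" if "a \<in> A" "w \<in> words ?B N" for a w
          proof -
            have "restrict (\<lambda>w. c (fill T a @ w)) (words ?B N) = restrict (\<lambda>w. c (fill T a0 @ w)) (words ?B N)"
              using Tc a0 that(1) by blast
            from fun_cong[OF this, of w] show ?thesis using that(2) unfolding d_def by simp
          qed
          have Ta0: "fill T a0 \<in> words ?B M" using fill_in_words[OF TB] a0 by auto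
          have dr: "d \<in> words ?B N \<rightarrow> {..<r}" unfolding d_def using cr Ta0 by auto
          from N[OF dr] show ?thesis
          proof
            assume "?mono N d"
            then obtain t where t: "is_line ?B N t" "\<forall>a\<in>?B. \<forall>a'\<in>?B. d (fill t a) = d (fill t a')"
              by blast
            let ?t = "map Some (fill T a0) @ t"
            have "is_line ?B (M + N) ?t" by (rule is_line_word_append[OF Ta0 t(1)])
            moreover have "c (fill ?t a) = c (fill ?t a')" if "a \<in> ?B" "a' \<in> ?B" for a a'
              using t(2)[rule_format, OF that] unfolding d_def by simp
            ultimately have "?mono (M + N) c" by blast
            then show ?thesis ..
          next
            assume "\<exists>K f. K \<subseteq> {..<r} \<and> card K = s \<and> focused A b N d K f"
            then obtain K f where K: "K \<subseteq> {..<r}" "card K = s" and f: "f \<in> words ?B N" "d f \<notin> K"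
              and Kt: "\<forall>x\<in>K. \<exists>t. is_line ?B N t \<and> fill t b = f \<and> (\<forall>a\<in>A. d (fill t a) = x)"
              unfolding focused_def by auto
            let ?f = "fill T b @ f" and ?K = "insert (d f) K"
            have lines: "\<exists>t. is_line ?B (M + N) t \<and> fill t b = ?f \<and> (\<forall>a\<in>A. c (fill t a) = x)"
              if "x \<in> ?K" for x
            proof (cases "x = d f")
              case True
              have "is_line ?B (M + N) (T @ map Some f)" by (rule is_line_append_word[OF TB f(1)])
              then show ?thesis using d f(1) True by (intro exI[of _ "T @ map Some f"]) simp
            next
              case False
              then have "x \<in> K" using that by simp
              from bspec[OF Kt this]
              obtain t where t: "is_line ?B N t" "fill t b = f" "\<forall>a\<in>A. d (fill t a) = x"
                by (elim exE conjE)
              have "c (fill (T @ t) a) = x" if "a \<in> A" for a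
                using d[OF that fill_in_words[OF t(1)], of a] t(3) that by simp
              moreover have "fill (T @ t) b = ?f" using t(2) by simp
              ultimately show ?thesis using is_line_append[OF TB t(1)] by metis
            qed
            have "?f \<in> words ?B (M + N)"
              by (rule words_append[OF fill_in_words[OF TB] f(1)]) simp
            moreover have "?K \<subseteq> {..<r}" using K(1) dr f(1) by auto
            moreover have "card ?K = Suc s"
              using K f(2) finite_subset[OF K(1)] by simp
            moreover have "?mono (M + N) c" if cf: "c ?f \<in> ?K"
            proof -
              obtain t where t: "is_line ?B (M + N) t" "fill t b = ?f" "\<forall>a\<in>A. c (fill t a) = c ?f"
                using lines[OF cf] by (elim exE conjE)
              have "c (fill t a) = c ?f" if "a \<in> ?B" for a using t that by (cases "a = b") auto
              \<comment> \<open>If the focus shares the colour of one of its lines, that line is monochromatic.\<close>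
              then show ?thesis using t(1) by metis
            qed
            moreover have "focused A b (M + N) c ?K ?f" if "c ?f \<notin> ?K"
              using calculation(1) that lines unfolding focused_def by blast
            ultimately show ?thesis by blast
          qed
        qed
        then show ?case by blast
      qed
      obtain N where N: "\<And>c. c \<in> words ?B N \<rightarrow> {..<r} \<Longrightarrow> ?mono N c \<or>
          (\<exists>K f. K \<subseteq> {..<r} \<and> card K = r \<and> focused A b N c K f)"
        using foc[of r] by blast
      have "?mono N c" if c: "c \<in> words ?B N \<rightarrow> {..<r}" for c
      proof (rule ccontr)
        assume "\<not> ?mono N c"
        with N[OF c] obtain K f where K: "K \<subseteq> {..<r}" "card K = r" "focused A b N c K f"
          by blast
        have "K = {..<r}" using card_subset_eq[OF _ K(1)] K(2) by simp
        then show False using K(3) c unfolding focused_def by auto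
      qed
      then show "\<exists>N. hales_jewett_for ?B N {..<r}" unfolding hales_jewett_for_def by blast
    qed
  qed
qed

theorem hales_jewett: "finite A \<Longrightarrow> finite C \<Longrightarrow> \<exists>N. hales_jewett_for A N C"
  using hales_jewett_for_finite_colours hales_jewett_nat_colours by blast

section \<open>Echelon matrices, rank and the map tau\<close>

lemma mat_mult_index:
  assumes "A \<in> carrier_mat n m" "B \<in> carrier_mat m k" "i < n" "j < k"
  shows "(A * B) $$ (i, j) = (\<Sum>l<m. A $$ (i, l) * B $$ (l, j))"
  using assms by (simp add: scalar_prod_def atLeast0LessThan)

text \<open>Full column rank reduced column echelon form with the pivot of column \<open>i\<close> in row \<open>j i\<close>. Keeping
the pivots as a parameter replaces spans by entries, which is what the block constructions below
need; that \<open>j\<close> increases is a consequence.\<close>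

definition echelon_with :: "nat \<Rightarrow> nat \<Rightarrow> (nat \<Rightarrow> nat) \<Rightarrow> 'a::field mat \<Rightarrow> bool" where
  "echelon_with n m j A \<longleftrightarrow> A \<in> carrier_mat n m \<and>
     (\<forall>i<m. j i < n \<and> (\<forall>b<m. A $$ (j i, b) = (if b = i then 1 else 0)) \<and>
        (\<forall>a<j i. \<forall>b<m. i \<le> b \<longrightarrow> A $$ (a, b) = 0))"

lemma echelon_withD:
  assumes "echelon_with n m j A"
  shows "A \<in> carrier_mat n m" "\<And>i. i < m \<Longrightarrow> j i < n"
    "\<And>i b. i < m \<Longrightarrow> b < m \<Longrightarrow> A $$ (j i, b) = (if b = i then 1 else 0)"
    "\<And>i a b. i < m \<Longrightarrow> a < j i \<Longrightarrow> b < m \<Longrightarrow> i \<le> b \<Longrightarrow> A $$ (a, b) = 0"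
  using assms unfolding echelon_with_def by blast+

lemma echelon_with_pivots_less:
  assumes A: "echelon_with n m j A" and "i < i'" "i' < m"
  shows "j i < j i'"
proof (rule ccontr)
  note D = echelon_withD[OF A]
  assume "\<not> j i < j i'"
  then consider "j i = j i'" | "j i' < j i" by linarith
  then show False
  proof cases
    case 1
    then show False using D(3)[of i' i] D(3)[of i i] assms(2,3) by simp
  next
    case 2
    then show False using D(4)[of i "j i'" i'] D(3)[of i' i'] assms(2,3) by simp
  qed
qed

lemma echelon_with_one: "echelon_with m m (\<lambda>i. i) (1\<^sub>m m)"
  unfolding echelon_with_def by auto

text \<open>Row \<open>j (i l)\<close> of \<open>R * A\<close> is row \<open>i l\<close> of \<open>A\<close>, and a row of \<open>R\<close> above the pivot of column \<open>i l\<close>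
only combines rows of \<open>A\<close> above \<open>i l\<close>. Thus the echelon matrices form a category, and the columns of
\<open>R * A\<close> span a subspace of the column space of \<open>R\<close>.\<close>

lemma echelon_with_mult:
  assumes R: "echelon_with n m j R" and A: "echelon_with m k i A"
  shows "echelon_with n k (\<lambda>b. j (i b)) (R * A)"
proof -
  note DR = echelon_withD[OF R] and DA = echelon_withD[OF A]
  have 1: "(R * A) $$ (j (i l), b) = (if b = l then 1 else 0)" if "l < k" "b < k" for l b
  proof -
    have "(R * A) $$ (j (i l), b) = (\<Sum>x<m. R $$ (j (i l), x) * A $$ (x, b))"
      by (rule mat_mult_index[OF DR(1) DA(1)]) (use that DR(2) DA(2) in auto)
    also have "\<dots> = (\<Sum>x<m. if x = i l then A $$ (i l, b) else 0)"
      by (rule sum.cong) (use that DR(3) DA(2) in auto)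
    also have "\<dots> = A $$ (i l, b)" using DA(2) that by simp
    finally show ?thesis using DA(3) that by simp
  qed
  have 2: "(R * A) $$ (a, b) = 0" if "l < k" "a < j (i l)" "b < k" "l \<le> b" for l a b
  proof -
    have "(R * A) $$ (a, b) = (\<Sum>x<m. R $$ (a, x) * A $$ (x, b))"
      by (rule mat_mult_index[OF DR(1) DA(1)]) (use that DR(2) DA(2) in \<open>auto intro: less_trans\<close>)
    also have "\<dots> = (\<Sum>x<m. 0)"
    proof (rule sum.cong)
      fix x assume "x \<in> {..<m}"
      then show "R $$ (a, x) * A $$ (x, b) = 0"
        using DR(4)[of "i l" a x] DA(4)[of l x b] DA(2)[of l] that by (cases "x < i l") auto
    qed simp
    finally show ?thesis by simp
  qed
  show ?thesis unfolding echelon_with_def using 1 2 DR(1,2) DA(1,2) by auto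
qed

text \<open>A form of full column rank that is preserved by products without any dimension count.\<close>

definition left_invertible :: "'a::field mat \<Rightarrow> bool" where
  "left_invertible A \<longleftrightarrow> (\<exists>L \<in> carrier_mat (dim_col A) (dim_row A). L * A = 1\<^sub>m (dim_col A))"

text \<open>The left inverse selects the pivot rows.\<close>

lemma echelon_with_left_invertible:
  assumes A: "echelon_with n m j A"
  shows "left_invertible A"
proof -
  note D = echelon_withD[OF A]
  let ?L = "mat m n (\<lambda>(i, a). if a = j i then 1 else 0) :: 'a mat"
  have "?L * A = 1\<^sub>m m"
  proof (rule eq_matI)
    fix i b assume ib: "i < dim_row (1\<^sub>m m :: 'a mat)" "b < dim_col (1\<^sub>m m :: 'a mat)"
    have "(?L * A) $$ (i, b) = (\<Sum>l<n. ?L $$ (i, l) * A $$ (l, b))"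
      by (rule mat_mult_index[OF _ D(1)]) (use ib in auto)
    also have "\<dots> = (\<Sum>l<n. if l = j i then A $$ (j i, b) else 0)"
      by (rule sum.cong) (use ib in auto)
    finally show "(?L * A) $$ (i, b) = 1\<^sub>m m $$ (i, b)" using D(2,3) ib by auto
  qed (use D(1) in auto)
  moreover have "?L \<in> carrier_mat m n" by simp
  ultimately show ?thesis unfolding left_invertible_def using D(1)
    by (metis carrier_matD)
qed

lemma mult_unit_vec: "(A :: 'a::field mat) \<in> carrier_mat n k \<Longrightarrow> i < k \<Longrightarrow> A *\<^sub>v unit_vec k i = col A i"
  by (intro eq_vecI) (auto simp: scalar_prod_right_unit)

lemma rank_full_iff_trivial_kernel:
  fixes A :: "'a::field mat"
  assumes A: "A \<in> carrier_mat n k"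
  shows "vec_space.rank n A = k \<longleftrightarrow> (\<forall>v \<in> carrier_vec k. A *\<^sub>v v = 0\<^sub>v n \<longrightarrow> v = 0\<^sub>v k)"
proof -
  interpret vec_space "TYPE('a)" n .
  show ?thesis
  proof
    assume r: "rank A = k"
    have dist: "distinct (cols A)"
    proof -
      obtain S where S: "maximal S (\<lambda>T. T \<subseteq> set (cols A) \<and> lin_indpt T)"
        using maximal_exists[of "(\<lambda>T. T \<subseteq> set (cols A) \<and> lin_indpt T)" "card (set (cols A))" "{}"]
        by (meson List.finite_set card_mono empty_iff empty_subsetI finite_lin_indpt2 rev_finite_subset)
      then have "card S = k" "S \<subseteq> set (cols A)" using rank_card_indpt[OF A S] r by (auto simp: maximal_def)
      then have "k \<le> card (set (cols A))" by (metis List.finite_set card_mono)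
      then show ?thesis using A card_length[of "cols A"] by (metis card_distinct carrier_matD(2) cols_length le_antisym)
    qed
    show "\<forall>v \<in> carrier_vec k. A *\<^sub>v v = 0\<^sub>v n \<longrightarrow> v = 0\<^sub>v k"
      using full_rank_lin_indpt[OF A r dist] lin_depI[OF A _ _ _ dist] by blast
  next
    assume k: "\<forall>v \<in> carrier_vec k. A *\<^sub>v v = 0\<^sub>v n \<longrightarrow> v = 0\<^sub>v k"
    have dist: "distinct (cols A)"
      unfolding distinct_conv_nth
    proof (intro allI impI notI)
      fix i j assume ij: "i < length (cols A)" "j < length (cols A)" "i \<noteq> j" "cols A ! i = cols A ! j"
      then have ijk: "i < k" "j < k" using A by auto
      have "A *\<^sub>v (unit_vec k i - unit_vec k j) = A *\<^sub>v unit_vec k i - A *\<^sub>v unit_vec k j"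
        using A by (intro mult_minus_distrib_mat_vec) auto
      also have "\<dots> = 0\<^sub>v n" using ij ijk A mult_unit_vec[OF A] by auto
      finally have "unit_vec k i - unit_vec k j = (0\<^sub>v k :: 'a vec)" using k by auto
      then have "(unit_vec k i - unit_vec k j) $ i = (0\<^sub>v k :: 'a vec) $ i" by simp
      then show False using ijk ij(3) by simp
    qed
    show "rank A = k"
      using lin_indpt_full_rank[OF A dist] lin_depE[OF A _ dist] k by metis
  qed
qed

lemma rank_full_if_left_invertible:
  fixes A :: "'a::field mat"
  assumes A: "A \<in> carrier_mat n k" and "left_invertible A"
  shows "vec_space.rank n A = k"
proof -
  obtain L where L: "L \<in> carrier_mat k n" "L * A = 1\<^sub>m k"
    using assms unfolding left_invertible_def by auto
  have "v = 0\<^sub>v k" if v: "v \<in> carrier_vec k" "A *\<^sub>v v = 0\<^sub>v n" for v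
  proof -
    have "v = (L * A) *\<^sub>v v" using L v by simp
    also have "\<dots> = L *\<^sub>v (A *\<^sub>v v)" by (rule assoc_mult_mat_vec[OF L(1) A v(1)])
    finally show ?thesis using v L(1) by auto
  qed
  then show ?thesis using rank_full_iff_trivial_kernel[OF A] by blast
qed

lemma GL_mats_inverse:
  assumes "T \<in> GL_mats k"
  obtains G where "T \<in> carrier_mat k k" "G \<in> carrier_mat k k" "G \<in> GL_mats k" "T * G = 1\<^sub>m k" "G * T = 1\<^sub>m k"
proof -
  from assms obtain G where T: "T \<in> carrier_mat k k" "T * G = 1\<^sub>m k" "G * T = 1\<^sub>m (dim_row G)"
    unfolding GL_mats_def invertible_mat_def inverts_mat_def by auto
  have G: "G \<in> carrier_mat k k"
    using arg_cong[OF T(2), of dim_col] arg_cong[OF T(3), of dim_col] T(1) by auto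
  then have "G \<in> GL_mats k" using T unfolding GL_mats_def invertible_mat_def inverts_mat_def by auto
  then show ?thesis using that T G by auto
qed

lemma GL_matsI: "T \<in> carrier_mat k k \<Longrightarrow> G \<in> carrier_mat k k \<Longrightarrow> T * G = 1\<^sub>m k \<Longrightarrow> G * T = 1\<^sub>m k \<Longrightarrow> T \<in> GL_mats k"
  unfolding GL_mats_def invertible_mat_def inverts_mat_def by auto

lemma left_invertible_mult:
  assumes A: "A \<in> carrier_mat n m" "left_invertible A" and B: "B \<in> carrier_mat m k" "left_invertible B"
  shows "left_invertible (A * B)"
proof -
  obtain L where L: "L \<in> carrier_mat m n" "L * A = 1\<^sub>m m"
    using A unfolding left_invertible_def by auto
  obtain K where K: "K \<in> carrier_mat k m" "K * B = 1\<^sub>m k"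
    using B unfolding left_invertible_def by auto
  have "(K * L) * (A * B) = K * (L * (A * B))" using K L A B by (intro assoc_mult_mat) auto
  also have "L * (A * B) = (L * A) * B" using K L A B by (intro assoc_mult_mat[symmetric]) auto
  also have "K * \<dots> = 1\<^sub>m k" using K L B by simp
  finally have "(K * L) * (A * B) = 1\<^sub>m k" .
  moreover have "K * L \<in> carrier_mat k n" using K L by simp
  ultimately show ?thesis unfolding left_invertible_def using A B
    by (metis carrier_matD index_mult_mat(2,3))
qed

lemma left_invertible_GL: "T \<in> GL_mats k \<Longrightarrow> left_invertible T"
  by (metis GL_mats_inverse carrier_matD left_invertible_def)

text \<open>Gauss--Jordan elimination of the transpose; no row of the result vanishes because the columns
of \<open>A\<close> are independent, so every row has a pivot.\<close>

lemma echelon_form_exists: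
  fixes A :: "'a::field mat"
  assumes A: "A \<in> carrier_mat n k" and r: "vec_space.rank n A = k"
  obtains T j where "T \<in> GL_mats k" "echelon_with n k j (A * T)"
proof -
  have At: "transpose_mat A \<in> carrier_mat k n" using A by simp
  define C where "C = gauss_jordan_single (transpose_mat A)"
  note gj = gauss_jordan_single[OF At C_def[symmetric]]
  from gj(4) obtain P Q where P: "C = P * transpose_mat A" "P \<in> carrier_mat k k" "Q \<in> carrier_mat k k"
    "P * Q = 1\<^sub>m k" "Q * P = 1\<^sub>m k" by blast
  from gj(2,3) obtain f where "pivot_fun C f n" unfolding row_echelon_form_def by auto
  note pf = pivot_funD[OF carrier_matD(1)[OF gj(2)] this]
  let ?T = "transpose_mat P"
  have T: "?T \<in> carrier_mat k k" using P by simp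
  have AT: "A * ?T = transpose_mat C"
    unfolding P(1) using transpose_mult[OF P(2) At] by simp
  have "transpose_mat Q * ?T = 1\<^sub>m k" "?T * transpose_mat Q = 1\<^sub>m k"
    using transpose_mult[OF P(2,3)] transpose_mult[OF P(3,2)] P(4,5) by (metis transpose_one)+
  then have GL: "?T \<in> GL_mats k" using T P(3) by (intro GL_matsI[of _ _ "transpose_mat Q"]) auto
  have "left_invertible ?T" using left_invertible_GL[OF GL] .
  then have "vec_space.rank k ?T = k" using rank_full_if_left_invertible[OF T] by blast
  then have kerT: "v = 0\<^sub>v k" if "v \<in> carrier_vec k" "?T *\<^sub>v v = 0\<^sub>v k" for v
    using rank_full_iff_trivial_kernel[OF T] that by blast
  have kerA: "v = 0\<^sub>v k" if "v \<in> carrier_vec k" "A *\<^sub>v v = 0\<^sub>v n" for v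
    using rank_full_iff_trivial_kernel[OF A] r that by blast
  have fn: "f i < n" if i: "i < k" for i
  proof (rule ccontr)
    assume "\<not> f i < n"
    then have z: "C $$ (i, a) = 0" if "a < n" for a using pf(1,2)[OF i] that by auto
    have "(A * ?T) *\<^sub>v unit_vec k i = 0\<^sub>v n"
      unfolding AT using z gj(2) i by (intro eq_vecI) auto
    then have "A *\<^sub>v (?T *\<^sub>v unit_vec k i) = 0\<^sub>v n"
      using assoc_mult_mat_vec[OF A T, of "unit_vec k i"] by simp
    then have "?T *\<^sub>v unit_vec k i = 0\<^sub>v k" using kerA T by auto
    then have "unit_vec k i = (0\<^sub>v k :: 'a vec)" using kerT by auto
    then show False using i by (metis index_unit_vec(1) index_zero_vec(1) zero_neq_one)
  qed
  have mono: "f i \<le> f (i + d)" if "i + d < k" for i d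
    using that
  proof (induction d)
    case (Suc d)
    then show ?case using pf(3)[of "i + d"] fn[of "i + d"] fn[of "Suc (i + d)"] by fastforce
  qed simp
  have "echelon_with n k f (transpose_mat C)"
    unfolding echelon_with_def
  proof (intro conjI allI impI)
    show "transpose_mat C \<in> carrier_mat n k" using gj(2) by simp
    fix i assume i: "i < k"
    show "f i < n" using fn i .
    show "transpose_mat C $$ (f i, b) = (if b = i then 1 else 0)" if "b < k" for b
      using pf(4,5)[OF i fn[OF i]] that gj(2) i fn[OF i] by auto
    show "transpose_mat C $$ (a, b) = 0" if "a < f i" "b < k" "i \<le> b" for a b
      using pf(2)[OF that(2), of a] mono[of i "b - i"] that gj(2) fn[OF i] by auto
  qed
  then show ?thesis using that GL AT by simp
qed

text \<open>This turns the condition on spans in the definition of the reduced echelon form into the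
vanishing of entries.\<close>

lemma span_initial_unit_vecs:
  fixes v :: "'a::field vec"
  assumes v: "v \<in> carrier_vec p" and i: "i \<le> p"
  shows "v \<in> vec_span p (unit_vec p ` {..<i}) \<longleftrightarrow> (\<forall>b<p. i \<le> b \<longrightarrow> v $ b = 0)"
proof -
  interpret vec_space "TYPE('a)" p .
  let ?U = "unit_vec p ` {..<i} :: 'a vec set"
  have U: "?U \<subseteq> carrier_vec p" by auto
  have inj: "inj_on (unit_vec p :: nat \<Rightarrow> 'a vec) {..<i}"
  proof (rule inj_onI)
    fix x y assume "x \<in> {..<i}" "y \<in> {..<i}" "unit_vec p x = (unit_vec p y :: 'a vec)"
    moreover from this have "unit_vec p x $ x = (unit_vec p y $ x :: 'a)" by simp
    ultimately show "x = y" using i by (auto split: if_splits)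
  qed
  show ?thesis
  proof
    assume "v \<in> span ?U"
    then obtain a where a: "v = lincomb a ?U" using finite_span[of ?U] U by auto
    show "\<forall>b<p. i \<le> b \<longrightarrow> v $ b = 0"
      unfolding a using lincomb_index[OF _ U, of _ a] i by (auto intro!: sum.neutral)
  next
    assume z: "\<forall>b<p. i \<le> b \<longrightarrow> v $ b = 0"
    have "v = lincomb (\<lambda>x. v \<bullet> x) ?U"
    proof (rule eq_vecI)
      fix b assume "b < dim_vec (lincomb (\<lambda>x. v \<bullet> x) ?U)"
      then have b: "b < p" using lincomb_dim[of ?U] U by auto
      have "lincomb (\<lambda>x. v \<bullet> x) ?U $ b = (\<Sum>x\<in>?U. (v \<bullet> x) * x $ b)" by (rule lincomb_index[OF b U])
      also have "\<dots> = (\<Sum>l<i. (v \<bullet> unit_vec p l) * unit_vec p l $ b)" by (simp add: sum.reindex[OF inj])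
      also have "\<dots> = (\<Sum>l<i. if l = b then v $ b else 0)"
        by (rule sum.cong) (use v i b in auto)
      finally show "v $ b = lincomb (\<lambda>x. v \<bullet> x) ?U $ b" using z b by auto
    qed (use v lincomb_dim[OF _ U] in simp)
    then show "v \<in> span ?U" using finite_span[of ?U] U by auto
  qed
qed

lemma left_invertible_if_rank_full:
  fixes A :: "'a::field mat"
  assumes A: "A \<in> carrier_mat n k" and r: "vec_space.rank n A = k"
  shows "left_invertible A"
proof -
  obtain T j where T: "T \<in> GL_mats k" and B: "echelon_with n k j (A * T)"
    using echelon_form_exists[OF A r] .
  obtain G where G: "T \<in> carrier_mat k k" "G \<in> carrier_mat k k" "G \<in> GL_mats k" "T * G = 1\<^sub>m k"
    using GL_mats_inverse[OF T] by metis
  have "left_invertible ((A * T) * G)"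
    by (rule left_invertible_mult[OF echelon_withD(1)[OF B] echelon_with_left_invertible[OF B]
          G(2) left_invertible_GL[OF G(3)]])
  moreover have "(A * T) * G = A"
    using assoc_mult_mat[OF A G(1,2)] A G(4) by simp
  ultimately show ?thesis by simp
qed

lemma rank_mats_full: "rank_mats n k k = {A \<in> carrier_mat n k. left_invertible A}"
  unfolding rank_mats_def
  using left_invertible_if_rank_full rank_full_if_left_invertible by blast

lemma echelon_with_mult_pivot_row:
  assumes B: "echelon_with n k j B" and M: "M \<in> carrier_mat k l" and i: "i < k" and b: "b < l"
  shows "(B * M) $$ (j i, b) = M $$ (i, b)"
proof -
  note D = echelon_withD[OF B]
  have "(B * M) $$ (j i, b) = (\<Sum>x<k. B $$ (j i, x) * M $$ (x, b))"
    by (rule mat_mult_index[OF D(1) M D(2)[OF i] b])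
  also have "\<dots> = (\<Sum>x<k. if x = i then M $$ (i, b) else 0)"
    by (rule sum.cong) (use D(3)[OF i] in auto)
  finally show ?thesis using i by simp
qed

text \<open>The definition of the reduced echelon form speaks of the rank of the transpose. Writing
\<open>A = B * G\<close> with \<open>B\<close> in echelon form, the pivot rows of \<open>A\<close> are the rows of the invertible
matrix \<open>G\<close>, so the transpose has \<open>k\<close> independent columns.\<close>

lemma rank_transpose_full:
  fixes A :: "'a::field mat"
  assumes A: "A \<in> carrier_mat n k" and r: "vec_space.rank n A = k"
  shows "vec_space.rank k (transpose_mat A) = k"
proof -
  interpret vec_space "TYPE('a)" k .
  have At: "transpose_mat A \<in> carrier_mat k n" using A by simp
  obtain T j where T: "T \<in> GL_mats k" and B: "echelon_with n k j (A * T)"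
    using echelon_form_exists[OF A r] .
  obtain G where G: "T \<in> carrier_mat k k" "G \<in> carrier_mat k k" "T * G = 1\<^sub>m k" "G * T = 1\<^sub>m k"
    using GL_mats_inverse[OF T] by metis
  have AG: "(A * T) * G = A"
    using assoc_mult_mat[OF A G(1,2)] A G(3) by simp
  let ?P = "transpose_mat G"
  have P: "?P \<in> carrier_mat k k" using G by simp
  have "transpose_mat T * ?P = 1\<^sub>m k"
    using transpose_mult[OF G(2,1)] G(4) by (metis transpose_one)
  then have "left_invertible ?P" unfolding left_invertible_def using G(1,2)
    by (metis P carrier_matD transpose_carrier_mat)
  then have rP: "rank ?P = k" by (rule rank_full_if_left_invertible[OF P])
  have sub: "set (cols ?P) \<subseteq> set (cols (transpose_mat A))"
  proof
    fix v assume "v \<in> set (cols ?P)"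
    then obtain i where i: "i < k" "v = row G i"
      using G(2) by (auto simp: in_set_conv_nth)
    have ji: "j i < n" using echelon_withD(2)[OF B i(1)] .
    have "row G i = row A (j i)"
      by (rule eq_vecI) (use echelon_with_mult_pivot_row[OF B G(2) i(1)] AG A G(2) i ji in auto)
    then have "v = cols (transpose_mat A) ! j i" using i ji A by simp
    then show "v \<in> set (cols (transpose_mat A))" using ji A
      by (metis cols_length index_transpose_mat(3) nth_mem carrier_matD(1))
  qed
  have max: "\<exists>S. maximal S (\<lambda>U. U \<subseteq> set (cols X) \<and> lin_indpt U)" for X
    using maximal_exists[of "(\<lambda>T. T \<subseteq> set (cols X) \<and> lin_indpt T)" "card (set (cols X))" "{}"]
    by (meson List.finite_set card_mono empty_iff empty_subsetI finite_lin_indpt2 rev_finite_subset)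
  obtain S where S: "maximal S (\<lambda>U. U \<subseteq> set (cols ?P) \<and> lin_indpt U)" using max by blast
  then have "k = card S" "S \<subseteq> set (cols (transpose_mat A))" "lin_indpt S"
    using rank_card_indpt[OF P S] rP sub by (auto simp: maximal_def)
  then have "k \<le> rank (transpose_mat A)" using rank_ge_card_indpt[OF At] by simp
  moreover have "rank (transpose_mat A) \<le> k"
  proof -
    obtain S where S: "maximal S (\<lambda>U. U \<subseteq> set (cols (transpose_mat A)) \<and> lin_indpt U)" using max by blast
    then have s: "S \<subseteq> carrier_vec k" "lin_indpt S"
      using cols_dim[of "transpose_mat A"] At A by (auto simp: maximal_def)
    then show ?thesis using rank_card_indpt[OF At S] li_le_dim(2)[OF fin_dim _ s(2)] dim_is_n by simp
  qed
  ultimately show ?thesis by simp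
qed

lemma is_rcef_iff_echelon:
  fixes A :: "'a::field mat"
  assumes A: "A \<in> carrier_mat n m" and r: "vec_space.rank n A = m"
  shows "is_rcef A \<longleftrightarrow> (\<exists>j. echelon_with n m j A)"
proof -
  interpret vec_space "TYPE('a)" m .
  let ?M = "transpose_mat A"
  let ?U = "\<lambda>i. unit_vec m ` {..<i} :: 'a vec set"
  have M: "?M \<in> carrier_mat m n" using A by simp
  have row: "?M *\<^sub>v unit_vec n a = row A a" if "a < n" for a
    using mult_unit_vec[OF M that] A that by simp
  have rowin: "row A a \<in> carrier_vec m" for a using row_carrier[of A a] A by simp
  have U: "?U i \<subseteq> carrier_vec m" for i by auto
  have rref: "is_rcef A \<longleftrightarrow> (\<exists>j. strict_mono_on {..<m} j \<and> (\<forall>i<m. j i < n \<and>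
      ?M *\<^sub>v unit_vec n (j i) = unit_vec m i \<and>
      span ((\<lambda>a. ?M *\<^sub>v unit_vec n a) ` {..<j i}) = span (?U i)))"
  proof -
    have "dim_row ?M = m" "dim_col ?M = n" using A by auto
    then show ?thesis
      unfolding is_rcef_def is_rref_def Let_def by (simp only: rank_transpose_full[OF A r])
  qed
  show ?thesis
  proof
    assume "is_rcef A"
    then obtain j where j: "\<And>i. i < m \<Longrightarrow> j i < n" "\<And>i. i < m \<Longrightarrow> ?M *\<^sub>v unit_vec n (j i) = unit_vec m i"
      "\<And>i. i < m \<Longrightarrow> span ((\<lambda>a. ?M *\<^sub>v unit_vec n a) ` {..<j i}) = span (?U i)"
      unfolding rref by blast
    have "A $$ (j i, b) = (if b = i then 1 else 0)" if "i < m" "b < m" for i b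
    proof -
      have "row A (j i) $ b = unit_vec m i $ b" using j(1,2)[OF that(1)] row by simp
      then show ?thesis using that j(1) A by (auto split: if_splits)
    qed
    moreover have "A $$ (a, b) = 0" if "i < m" "a < j i" "b < m" "i \<le> b" for i a b
    proof -
      have a: "a < n" using j(1)[OF that(1)] that(2) by simp
      have "(\<lambda>a. ?M *\<^sub>v unit_vec n a) ` {..<j i} \<subseteq> carrier_vec m" using M by auto
      from in_own_span[OF this] have "?M *\<^sub>v unit_vec n a \<in> span (?U i)"
        using that(2) unfolding j(3)[OF that(1)] by blast
      then have "row A a \<in> span (?U i)" unfolding row[OF a] .
      then have "row A a $ b = 0"
        using span_initial_unit_vecs[OF rowin less_imp_le[OF that(1)]] that(3,4) by blast
      then show ?thesis using a that A by simp
    qed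
    ultimately show "\<exists>j. echelon_with n m j A" unfolding echelon_with_def using A j(1) by blast
  next
    assume "\<exists>j. echelon_with n m j A"
    then obtain j where j: "echelon_with n m j A" ..
    note D = echelon_withD[OF j]
    have "strict_mono_on {..<m} j"
      by (rule strict_mono_onI) (use echelon_with_pivots_less[OF j] in auto)
    moreover have rowu: "?M *\<^sub>v unit_vec n (j i) = unit_vec m i" if "i < m" for i
      unfolding row[OF D(2)[OF that]]
      by (rule eq_vecI) (use D(2,3) that A in auto)
    moreover have "span ((\<lambda>a. ?M *\<^sub>v unit_vec n a) ` {..<j i}) = span (?U i)" if i: "i < m" for i
    proof
      have "(\<lambda>a. ?M *\<^sub>v unit_vec n a) ` {..<j i} \<subseteq> span (?U i)"
      proof
        fix v assume "v \<in> (\<lambda>a. ?M *\<^sub>v unit_vec n a) ` {..<j i}"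
        then obtain a where a: "a < j i" "v = row A a" "a < n"
          using row D(2)[OF i] less_trans by fastforce
        then have "\<forall>b<m. i \<le> b \<longrightarrow> row A a $ b = 0" using D(4)[OF i] A by simp
        then show "v \<in> span (?U i)"
          unfolding a(2) using span_initial_unit_vecs[OF rowin less_imp_le[OF i]] by blast
      qed
      then show "span ((\<lambda>a. ?M *\<^sub>v unit_vec n a) ` {..<j i}) \<subseteq> span (?U i)"
        by (intro span_is_subset span_is_submodule) (use U in auto)
      have "?U i \<subseteq> (\<lambda>a. ?M *\<^sub>v unit_vec n a) ` {..<j i}"
      proof
        fix v assume "v \<in> ?U i"
        then obtain l where l: "l < i" "v = unit_vec m l" by auto
        then have "v = ?M *\<^sub>v unit_vec n (j l)" "j l < j i"
          using rowu[of l] i echelon_with_pivots_less[OF j, of l i] by auto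
        then show "v \<in> (\<lambda>a. ?M *\<^sub>v unit_vec n a) ` {..<j i}" by blast
      qed
      then show "span (?U i) \<subseteq> span ((\<lambda>a. ?M *\<^sub>v unit_vec n a) ` {..<j i})"
        by (rule span_is_monotone)
    qed
    ultimately show "is_rcef A" unfolding rref using D(2) by blast
  qed
qed

lemma echelon_with_rank_mats: "echelon_with n m j A \<Longrightarrow> A \<in> rank_mats n m m"
  using echelon_withD(1) echelon_with_left_invertible rank_mats_full by blast

lemma rcef_mats_iff_echelon: "A \<in> rcef_mats n m \<longleftrightarrow> (\<exists>j. echelon_with n m j A)"
  using is_rcef_iff_echelon echelon_with_rank_mats
  unfolding rcef_mats_def rank_mats_def by blast

text \<open>If the pivot of \<open>B\<close> came first, row \<open>j i\<close> of \<open>B * G\<close>, which is row \<open>i\<close> of \<open>G\<close>, would be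
zero from the diagonal on. The first \<open>i\<close> rows of \<open>H\<close> are those of the identity,
so every summand of the diagonal entry \<open>(i, i)\<close> of \<open>G * H\<close> would vanish, but this entry is \<open>1\<close>.\<close>

lemma echelon_pivots_not_less:
  assumes B: "echelon_with n k j B" and BG: "echelon_with n k j' (B * G)"
    and G: "G \<in> carrier_mat k k" and H: "H \<in> carrier_mat k k" "G * H = 1\<^sub>m k"
    and i: "i < k" and Hrows: "\<And>l b. l < i \<Longrightarrow> b < k \<Longrightarrow> H $$ (l, b) = (if b = l then 1 else 0)"
  shows "\<not> j i < j' i"
proof
  assume less: "j i < j' i"
  have "G $$ (i, b) * H $$ (b, i) = 0" if "b < k" for b
  proof (cases "b < i")
    case True
    then show ?thesis using Hrows[OF True i] by simp
  next
    case False
    then show ?thesis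
      using echelon_withD(4)[OF BG i less that] echelon_with_mult_pivot_row[OF B G i that] by simp
  qed
  then have "(G * H) $$ (i, i) = 0"
    unfolding mat_mult_index[OF G H(1) i i] by (intro sum.neutral) simp
  then show False using H(2) i by simp
qed

text \<open>By induction on the columns: the first \<open>i\<close> rows of \<open>G\<close> and of its inverse are those of the
identity, so the pivots of column \<open>i\<close> agree by the preceding lemma used in both directions, and
then row \<open>i\<close> of \<open>G\<close> is the pivot row of \<open>B * G\<close>.\<close>

lemma echelon_with_unique:
  assumes B: "echelon_with n k j B" and BG: "echelon_with n k j' (B * G)"
    and G: "G \<in> carrier_mat k k" and H: "H \<in> carrier_mat k k" "G * H = 1\<^sub>m k" "H * G = 1\<^sub>m k"
  shows "G = 1\<^sub>m k"
proof -
  have BGH: "(B * G) * H = B"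
    using assoc_mult_mat[OF echelon_withD(1)[OF B] G H(1)] echelon_withD(1)[OF B] H(2) by simp
  have "i < k \<longrightarrow> (\<forall>b<k. G $$ (i, b) = (if b = i then 1 else 0) \<and> H $$ (i, b) = (if b = i then 1 else 0))" for i
  proof (induction i rule: less_induct)
    case (less i)
    show ?case
    proof
      assume i: "i < k"
      have "\<not> j i < j' i" by (rule echelon_pivots_not_less[OF B BG G H(1,2) i]) (use less i in auto)
      moreover have "\<not> j' i < j i"
        by (rule echelon_pivots_not_less[OF BG, of j H G]) (use less i B BGH G H in auto)
      ultimately have ji: "j i = j' i" by simp
      show "\<forall>b<k. G $$ (i, b) = (if b = i then 1 else 0) \<and> H $$ (i, b) = (if b = i then 1 else 0)"
        using echelon_with_mult_pivot_row[OF B G i] echelon_with_mult_pivot_row[OF BG H(1) i]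
          echelon_withD(3)[OF B i] echelon_withD(3)[OF BG i] ji BGH by metis
    qed
  qed
  then show ?thesis using G by (intro eq_matI) auto
qed

lemma mult_inverse_cancel:
  fixes A :: "'a::field mat"
  assumes "A \<in> carrier_mat k k" "B \<in> carrier_mat k k" "C \<in> carrier_mat k k" "D \<in> carrier_mat k k"
    and "B * C = 1\<^sub>m k" "A * D = 1\<^sub>m k"
  shows "(A * B) * (C * D) = 1\<^sub>m k"
proof -
  have "(A * B) * (C * D) = A * (B * (C * D))" using assms(1-4) by (intro assoc_mult_mat) auto
  also have "B * (C * D) = (B * C) * D" using assms(2-4) by (intro assoc_mult_mat[symmetric]) auto
  finally show ?thesis using assms by simp
qed

lemma tau_unique:
  assumes A: "A \<in> carrier_mat n k" and T: "T \<in> GL_mats k" and B: "echelon_with n k j (A * T)"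
  shows "tau A = T"
proof -
  have dA: "dim_col A = k" using A by simp
  obtain G where G: "T \<in> carrier_mat k k" "G \<in> carrier_mat k k" "T * G = 1\<^sub>m k" "G * T = 1\<^sub>m k"
    using GL_mats_inverse[OF T] by metis
  have "is_rcef (A * T)" using B rcef_mats_iff_echelon unfolding rcef_mats_def by blast
  moreover have "T' = T" if T': "T' \<in> GL_mats k" and R: "is_rcef (A * T')" for T'
  proof -
    obtain G' where G': "T' \<in> carrier_mat k k" "G' \<in> carrier_mat k k" "T' * G' = 1\<^sub>m k" "G' * T' = 1\<^sub>m k"
      using GL_mats_inverse[OF T'] by metis
    have AG: "(A * T) * G = A" using assoc_mult_mat[OF A G(1,2)] A G(3) by simp
    have BT: "(A * T) * (G * T') = A * T'"
      using assoc_mult_mat[OF echelon_withD(1)[OF B] G(2) G'(1)] AG by simp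
    have "left_invertible ((A * T) * (G * T'))"
      using left_invertible_mult[OF _ _ G'(1) left_invertible_GL[OF T'], of A n]
        left_invertible_mult[OF echelon_withD(1)[OF B] echelon_with_left_invertible[OF B] G(2)]
        left_invertible_GL[OF GL_matsI[OF G(2,1,4,3)]] A unfolding AG BT by simp
    then have "A * T' \<in> rank_mats n k k" unfolding rank_mats_full BT using A G'(1) by auto
    then obtain j' where j': "echelon_with n k j' ((A * T) * (G * T'))"
      using R rcef_mats_iff_echelon unfolding rcef_mats_def BT by blast
    have 1: "(G * T') * (G' * T) = 1\<^sub>m k" and 2: "(G' * T) * (G * T') = 1\<^sub>m k"
      using mult_inverse_cancel[OF G(2) G'(1,2) G(1) G'(3) G(4)]
        mult_inverse_cancel[OF G'(2) G(1,2) G'(1) G(3) G'(4)] by auto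
    have "G * T' = 1\<^sub>m k"
      by (rule echelon_with_unique[OF B j' _ _ 1 2]) (use G G' in auto)
    then have "T * (G * T') = T" using G by simp
    then show ?thesis using G G' assoc_mult_mat[OF G(1,2) G'(1)] by simp
  qed
  ultimately show ?thesis unfolding tau_def dA using T by (intro the_equality) blast+
qed

lemma tau_rank_mats:
  assumes "A \<in> rank_mats n k k"
  obtains j where "tau A \<in> GL_mats k" "echelon_with n k j (A * tau A)"
proof -
  have A: "A \<in> carrier_mat n k" "vec_space.rank n A = k" using assms unfolding rank_mats_def by auto
  obtain T j where "T \<in> GL_mats k" "echelon_with n k j (A * T)" using echelon_form_exists[OF A] .
  then show ?thesis using tau_unique[OF A(1)] that by metis
qed

text \<open>The matrix that brings \<open>A\<close> into echelon form does the same for \<open>R * A\<close>, because echelon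
matrices are closed under products. Hence \<open>tau\<close> separates a matrix into an echelon part, which is
to be made irrelevant for the colour, and an invertible part, which is kept.\<close>

lemma tau_echelon_mult:
  assumes R: "echelon_with n m j R" and A: "A \<in> rank_mats m k k"
  shows "tau (R * A) = tau A"
proof -
  obtain i where i: "tau A \<in> GL_mats k" "echelon_with m k i (A * tau A)" using tau_rank_mats[OF A] .
  have A': "A \<in> carrier_mat m k" using A unfolding rank_mats_def by simp
  have T: "tau A \<in> carrier_mat k k" using i(1) GL_mats_def by blast
  have "(R * A) * tau A = R * (A * tau A)"
    by (rule assoc_mult_mat[OF echelon_withD(1)[OF R] A' T])
  then have "echelon_with n k (\<lambda>b. j (i b)) ((R * A) * tau A)"
    using echelon_with_mult[OF R i(2)] by simp
  then show ?thesis
    by (intro tau_unique[OF _ i(1)]) (use echelon_withD(1)[OF R] A' in auto)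
qed

section \<open>Colourings that depend only on an initial block of rows\<close>

lemma finite_carrier_mat: "finite (carrier_mat n m :: 'a::finite mat set)"
proof -
  let ?I = "{..<n} \<times> {..<m}"
  have "A \<in> mat n m ` (?I \<rightarrow>\<^sub>E UNIV)" if "A \<in> carrier_mat n m" for A :: "'a mat"
  proof
    show "A = mat n m (restrict (($$) A) ?I)" using that by (intro eq_matI) auto
  qed auto
  then have "carrier_mat n m \<subseteq> mat n m ` (?I \<rightarrow>\<^sub>E (UNIV :: 'a set))" by blast
  moreover have "finite (?I \<rightarrow>\<^sub>E (UNIV :: 'a set))" by (intro finite_PiE) auto
  ultimately show ?thesis using finite_subset finite_imageI by metis
qed

text \<open>The affine form of the Hales--Jewett theorem. The letters are \<open>M \<times> q\<close> blocks, and stacking the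
letters of a word gives a tall matrix. A line becomes \<open>Z + S * y\<close>, where \<open>S\<close> has an identity block at
each active position and \<open>Z\<close> holds the constant letters. The pivots of \<open>S\<close> lie in the first active
block, where \<open>Z\<close> is zero; that is what later makes the combined matrix reduced.\<close>

lemma affine_ramsey:
  fixes C :: "'c set"
  assumes C: "finite C"
  shows "\<exists>N. \<forall>c \<in> (carrier_mat N q :: 'a::{field,finite} mat set) \<rightarrow> C.
    \<exists>Z \<in> carrier_mat N q. \<exists>S j. echelon_with N M j S \<and>
      (\<forall>i<M. \<forall>b<q. Z $$ (j i, b) = 0) \<and>
      (\<forall>y \<in> carrier_mat M q. \<forall>y' \<in> carrier_mat M q. c (Z + S * y) = c (Z + S * y'))"
proof -
  obtain L where L: "hales_jewett_for (carrier_mat M q :: 'a mat set) L C"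
    using hales_jewett[OF finite_carrier_mat C] by blast
  let ?N = "L * M"
  define stack :: "'a mat list \<Rightarrow> 'a mat"
    where "stack w = mat ?N q (\<lambda>(a, b). w ! (a div M) $$ (a mod M, b))" for w
  have "\<exists>Z \<in> carrier_mat ?N q. \<exists>S j. echelon_with ?N M j S \<and>
      (\<forall>i<M. \<forall>b<q. Z $$ (j i, b) = 0) \<and>
      (\<forall>y \<in> carrier_mat M q. \<forall>y' \<in> carrier_mat M q. c (Z + S * y) = c (Z + S * y'))"
    if c: "c \<in> (carrier_mat ?N q :: 'a mat set) \<rightarrow> C" for c
  proof -
    have "(\<lambda>w. c (stack w)) \<in> words (carrier_mat M q) L \<rightarrow> C"
      using c unfolding stack_def by auto
    then obtain t where t: "is_line (carrier_mat M q) L t" and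
      ct: "\<forall>y \<in> carrier_mat M q. \<forall>y' \<in> carrier_mat M q. c (stack (fill t y)) = c (stack (fill t y'))"
      using L unfolding hales_jewett_for_def by meson
    have len: "length t = L" using t unfolding is_line_def by simp
    have "\<exists>a. a < L \<and> t ! a = None"
      using t unfolding is_line_def by (metis in_set_conv_nth)
    then obtain a0 where a0: "a0 < L" "t ! a0 = None" and before: "\<And>a. a < a0 \<Longrightarrow> t ! a \<noteq> None"
      using exists_least_iff[of "\<lambda>a. a < L \<and> t ! a = None"] by (metis less_trans)
    define Z :: "'a mat" where
      "Z = mat ?N q (\<lambda>(a, b). case t ! (a div M) of None \<Rightarrow> 0 | Some y \<Rightarrow> y $$ (a mod M, b))"
    define S :: "'a mat" where
      "S = mat ?N M (\<lambda>(a, b). if t ! (a div M) = None \<and> a mod M = b then 1 else 0)"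
    have ZS: "Z \<in> carrier_mat ?N q" "S \<in> carrier_mat ?N M" unfolding Z_def S_def by auto
    have pivot_bound: "a0 * M + i < ?N" if "i < M" for i
    proof -
      have "Suc a0 * M \<le> L * M" using a0(1) by (intro mult_right_mono) auto
      then show ?thesis using that by simp
    qed
    have "echelon_with ?N M (\<lambda>i. a0 * M + i) S"
      unfolding echelon_with_def
    proof (intro conjI allI impI ZS)
      fix i assume i: "i < M"
      show N: "a0 * M + i < ?N" using pivot_bound[OF i] .
      show "S $$ (a0 * M + i, b) = (if b = i then 1 else 0)" if "b < M" for b
        unfolding S_def using N i that a0(2) by auto
      show "S $$ (a, b) = 0" if a: "a < a0 * M + i" and b: "b < M" "i \<le> b" for a b
      proof (cases "t ! (a div M) = None \<and> a mod M = b")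
        case True
        then have "a0 \<le> a div M" using before not_less by blast
        then have "a0 * M + b \<le> a div M * M + a mod M"
          using True by (intro add_mono mult_right_mono) auto
        then show ?thesis using a b by simp
      next
        case False
        then show ?thesis unfolding S_def using a b N by auto
      qed
    qed
    moreover have "\<forall>i<M. \<forall>b<q. Z $$ (a0 * M + i, b) = 0"
      unfolding Z_def using pivot_bound a0(2) by auto
    moreover have "stack (fill t y) = Z + S * y" if y: "y \<in> carrier_mat M q" for y
    proof (rule eq_matI)
      fix a b assume "a < dim_row (Z + S * y)" "b < dim_col (Z + S * y)"
      then have ab: "a < ?N" "b < q" using ZS y by auto
      then have aM: "a div M < L" "a mod M < M"
        using less_mult_imp_div_less by (blast, metis mod_less_divisor mult_0_right not_less_zero gr0I)
      have "(S * y) $$ (a, b) = (\<Sum>l<M. S $$ (a, l) * y $$ (l, b))"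
        by (rule mat_mult_index[OF ZS(2) y ab])
      also have "\<dots> = (\<Sum>l<M. if l = a mod M then (if t ! (a div M) = None then y $$ (a mod M, b) else 0) else 0)"
        by (rule sum.cong) (use ab in \<open>auto simp: S_def\<close>)
      finally have "(S * y) $$ (a, b) = (if t ! (a div M) = None then y $$ (a mod M, b) else 0)"
        using aM by simp
      then show "stack (fill t y) $$ (a, b) = (Z + S * y) $$ (a, b)"
        using ab aM len ZS y by (auto simp: stack_def fill_def Z_def split: option.splits)
    qed (use ZS y in \<open>auto simp: stack_def\<close>)
    ultimately show ?thesis using ct ZS(1) by metis
  qed
  then show ?thesis by blast
qed

definition top_rows :: "nat \<Rightarrow> 'a mat \<Rightarrow> 'a mat" where
  "top_rows p X = mat p (dim_col X) (\<lambda>(a, b). X $$ (a, b))"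

lemma top_rows_carrier [simp]: "X \<in> carrier_mat n k \<Longrightarrow> top_rows p X \<in> carrier_mat p k"
  unfolding top_rows_def by auto

lemma top_rows_index [simp]: "a < p \<Longrightarrow> b < dim_col X \<Longrightarrow> top_rows p X $$ (a, b) = X $$ (a, b)"
  unfolding top_rows_def by simp

lemma top_rows_top_rows: "p \<le> q \<Longrightarrow> top_rows p (top_rows q X) = top_rows p X"
  unfolding top_rows_def by (intro eq_matI) auto

lemma top_rows_cong: "top_rows q X = top_rows q Y \<Longrightarrow> p \<le> q \<Longrightarrow> top_rows p X = top_rows p Y"
  by (metis top_rows_top_rows)

lemma top_rows_eqI:
  assumes "X \<in> carrier_mat n k" "Y \<in> carrier_mat n' k"
    and "\<And>a b. a < p \<Longrightarrow> b < k \<Longrightarrow> X $$ (a, b) = Y $$ (a, b)"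
  shows "top_rows p X = top_rows p Y"
  using assms by (intro eq_matI) (auto simp: top_rows_def)

lemma top_rows_eqD:
  assumes "X \<in> carrier_mat n k" "Y \<in> carrier_mat n' k" "top_rows p X = top_rows p Y" "a < p" "b < k"
  shows "X $$ (a, b) = Y $$ (a, b)"
  using assms top_rows_index carrier_matD(2) by metis

lemma append_rows_index:
  assumes "B \<in> carrier_mat q k" "y \<in> carrier_mat M k" "a < q + M" "b < k"
  shows "(B @\<^sub>r y) $$ (a, b) = (if a < q then B $$ (a, b) else y $$ (a - q, b))"
  using assms unfolding append_rows_def by (subst index_mat_four_block) auto

lemma top_rows_append:
  assumes "B \<in> carrier_mat q k" "y \<in> carrier_mat M k"
  shows "top_rows q (B @\<^sub>r y) = B"
proof -
  have "dim_col (B @\<^sub>r y) = k" using carrier_append_rows[OF assms] by auto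
  then show ?thesis
    using assms append_rows_index[OF assms] by (intro eq_matI) (auto simp: top_rows_def)
qed

lemma split_top_rows:
  assumes X: "X \<in> carrier_mat (q + M) k"
  obtains y where "y \<in> carrier_mat M k" "X = top_rows q X @\<^sub>r y"
proof
  let ?y = "mat M k (\<lambda>(a, b). X $$ (q + a, b))"
  show y: "?y \<in> carrier_mat M k" by simp
  have T: "top_rows q X \<in> carrier_mat q k" using X by simp
  show "X = top_rows q X @\<^sub>r ?y"
  proof (rule eq_matI)
    have c: "top_rows q X @\<^sub>r ?y \<in> carrier_mat (q + M) k" using carrier_append_rows[OF T y] .
    show "dim_row X = dim_row (top_rows q X @\<^sub>r ?y)" "dim_col X = dim_col (top_rows q X @\<^sub>r ?y)"
      using X carrier_matD[OF c] by auto
    fix a b assume "a < dim_row (top_rows q X @\<^sub>r ?y)" "b < dim_col (top_rows q X @\<^sub>r ?y)"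
    then have "a < q + M" "b < k" using carrier_matD[OF c] by auto
    then show "X $$ (a, b) = (top_rows q X @\<^sub>r ?y) $$ (a, b)"
      using append_rows_index[OF T y] X by auto
  qed
qed

text \<open>Below the first \<open>q\<close> rows, this matrix acts as the affine map \<open>y \<mapsto> Z * B + S * y\<close>.\<close>

lemma block_mult_append_rows:
  fixes Z :: "'a::field mat"
  assumes Z: "Z \<in> carrier_mat N q" and S: "S \<in> carrier_mat N M"
    and B: "B \<in> carrier_mat q k" and y: "y \<in> carrier_mat M k"
  shows "four_block_mat (1\<^sub>m q) (0\<^sub>m q M) Z S * (B @\<^sub>r y) = B @\<^sub>r (Z * B + S * y)"
proof -
  have "four_block_mat (1\<^sub>m q) (0\<^sub>m q M) Z S * (B @\<^sub>r y)
    = four_block_mat (1\<^sub>m q * B + 0\<^sub>m q M * y) (1\<^sub>m q * 0\<^sub>m q 0 + 0\<^sub>m q M * 0\<^sub>m M 0)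
        (Z * B + S * y) (Z * 0\<^sub>m q 0 + S * 0\<^sub>m M 0)"
    unfolding append_rows_def using assms
    by (subst mult_four_block_mat[of _ q q _ M _ N _ _ k _ 0]) auto
  also have "\<dots> = B @\<^sub>r (Z * B + S * y)"
    unfolding append_rows_def using assms by simp
  finally show ?thesis .
qed

text \<open>The pivot rows of \<open>S\<close> stay unit rows only if \<open>Z\<close> vanishes there.\<close>

lemma echelon_with_block:
  fixes Z :: "'a::field mat"
  assumes Z: "Z \<in> carrier_mat N q" and S: "echelon_with N M j S"
    and Z0: "\<And>i b. i < M \<Longrightarrow> b < q \<Longrightarrow> Z $$ (j i, b) = 0"
  shows "echelon_with (q + N) (q + M) (\<lambda>i. if i < q then i else q + j (i - q))
    (four_block_mat (1\<^sub>m q) (0\<^sub>m q M) Z S)"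
proof -
  note D = echelon_withD[OF S]
  let ?R = "four_block_mat (1\<^sub>m q) (0\<^sub>m q M) Z S"
  let ?j = "\<lambda>i. if i < q then i else q + j (i - q)"
  have R: "?R $$ (a, b) = (if a < q then (if b = a then 1 else 0)
      else (if b < q then Z $$ (a - q, b) else S $$ (a - q, b - q)))" if "a < q + N" "b < q + M" for a b
    using that D(1) Z by (subst index_mat_four_block) auto
  have bound: "?j i < q + N" if "i < q + M" for i
    using D(2)[of "i - q"] that by auto
  have "?R $$ (?j i, b) = (if b = i then 1 else 0)" if "i < q + M" "b < q + M" for i b
    unfolding R[OF bound[OF that(1)] that(2)]
    using D(3)[of "i - q" "b - q"] Z0[of "i - q" b] that by auto
  moreover have "?R $$ (a, b) = 0" if "i < q + M" "a < ?j i" "b < q + M" "i \<le> b" for i a b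
  proof -
    have "a < q + N" using bound[OF that(1)] that(2) by linarith
    then show ?thesis
      using D(4)[of "i - q" "a - q" "b - q"] that by (subst R) (auto split: if_splits)
  qed
  moreover have "?R \<in> carrier_mat (q + N) (q + M)"
    using D(1) Z by (intro four_block_carrier_mat) auto
  ultimately show ?thesis unfolding echelon_with_def using bound by blast
qed

text \<open>A prefix \<open>B\<close> with a left inverse spans all rows, so every continuation \<open>y\<close> of \<open>B\<close> has the form
\<open>w * B\<close>. Therefore the continuations of all prefixes are controlled at once by the matrices \<open>W\<close> over
the fixed alphabet of rows of length \<open>q\<close>: each \<open>W\<close> is coloured by the function that sends \<open>B\<close> to the
colour of \<open>B\<close> continued by \<open>W * B\<close>, and the affine theorem makes that function independent of \<open>w\<close>.
Working with \<open>W\<close> and not with \<open>W * B\<close> is essential, since the constants \<open>Z\<close> must not depend on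
\<open>B\<close>.\<close>

lemma block_ramsey:
  "\<exists>N. \<forall>c :: 'a::{field,finite} mat \<Rightarrow> nat. (\<forall>X. c X < r) \<longrightarrow>
    (\<exists>R j. echelon_with (q + N) (q + M) j R \<and>
      (\<forall>X \<in> carrier_mat (q + M) k. top_rows q (R * X) = top_rows q X) \<and>
      (\<forall>X \<in> carrier_mat (q + M) k. \<forall>X' \<in> carrier_mat (q + M) k.
        top_rows q X = top_rows q X' \<longrightarrow> left_invertible (top_rows q X) \<longrightarrow> c (R * X) = c (R * X')))"
proof -
  let ?C = "(carrier_mat q k :: 'a mat set) \<rightarrow>\<^sub>E {..<r}"
  have "finite ?C" by (intro finite_PiE finite_carrier_mat) auto
  from affine_ramsey[OF this, of q M]
  obtain N where N: "\<And>c. c \<in> (carrier_mat N q :: 'a mat set) \<rightarrow> ?C \<Longrightarrow>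
    \<exists>Z \<in> carrier_mat N q. \<exists>S j. echelon_with N M j S \<and>
      (\<forall>i<M. \<forall>b<q. Z $$ (j i, b) = 0) \<and>
      (\<forall>y \<in> carrier_mat M q. \<forall>y' \<in> carrier_mat M q. c (Z + S * y) = c (Z + S * y'))" by blast
  show ?thesis
  proof (intro exI[of _ N] allI impI)
    fix c :: "'a mat \<Rightarrow> nat" assume c: "\<forall>X. c X < r"
    \<comment> \<open>All prefixes are treated at once by a product colouring.\<close>
    define d where "d W = restrict (\<lambda>B. c (B @\<^sub>r (W * B))) (carrier_mat q k)" for W
    have "d \<in> carrier_mat N q \<rightarrow> ?C" unfolding d_def using c by auto
    from N[OF this] obtain Z S j where Z: "Z \<in> carrier_mat N q" and S: "echelon_with N M j S"
      and Z0: "\<forall>i<M. \<forall>b<q. Z $$ (j i, b) = 0"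
      and dZS: "\<forall>y \<in> carrier_mat M q. \<forall>y' \<in> carrier_mat M q. d (Z + S * y) = d (Z + S * y')"
      by blast
    note Sc = echelon_withD(1)[OF S]
    let ?R = "four_block_mat (1\<^sub>m q) (0\<^sub>m q M) Z S"
    have "echelon_with (q + N) (q + M) (\<lambda>i. if i < q then i else q + j (i - q)) ?R"
      by (rule echelon_with_block[OF Z S]) (use Z0 in auto)
    moreover have "top_rows q (?R * X) = top_rows q X" if X: "X \<in> carrier_mat (q + M) k" for X
    proof -
      obtain y where y: "y \<in> carrier_mat M k" "X = top_rows q X @\<^sub>r y" using split_top_rows[OF X] .
      have B: "top_rows q X \<in> carrier_mat q k" using X by simp
      have "?R * X = top_rows q X @\<^sub>r (Z * top_rows q X + S * y)"
        using block_mult_append_rows[OF Z Sc B y(1)] y(2) by simp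
      then show ?thesis
        using top_rows_append[OF B, of "Z * top_rows q X + S * y" N] Z Sc B y(1) by simp
    qed
    moreover have "c (?R * X) = c (?R * X')"
      if X: "X \<in> carrier_mat (q + M) k" and X': "X' \<in> carrier_mat (q + M) k"
        and eq: "top_rows q X = top_rows q X'" and inv: "left_invertible (top_rows q X)" for X X'
    proof -
      let ?B = "top_rows q X"
      have B: "?B \<in> carrier_mat q k" using X by simp
      obtain L where L: "L \<in> carrier_mat k q" "L * ?B = 1\<^sub>m k"
        using inv B unfolding left_invertible_def by auto
      have form: "\<exists>w \<in> carrier_mat M q. c (?R * (?B @\<^sub>r y)) = d (Z + S * w) ?B"
        if y: "y \<in> carrier_mat M k" for y
      proof
        show w: "y * L \<in> carrier_mat M q" using y L by simp
        have "(y * L) * ?B = y" using assoc_mult_mat[OF y L(1) B] L y by simp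
        then have "S * y = (S * (y * L)) * ?B" using assoc_mult_mat[OF Sc w B] by simp
        then have "Z * ?B + S * y = (Z + S * (y * L)) * ?B"
          using add_mult_distrib_mat[OF Z _ B, of "S * (y * L)"] Sc w by simp
        then show "c (?R * (?B @\<^sub>r y)) = d (Z + S * (y * L)) ?B"
          unfolding block_mult_append_rows[OF Z Sc B y] d_def using B by simp
      qed
      obtain y where y: "y \<in> carrier_mat M k" "X = ?B @\<^sub>r y" using split_top_rows[OF X] .
      obtain y' where y': "y' \<in> carrier_mat M k" "X' = ?B @\<^sub>r y'"
        using split_top_rows[OF X'] eq by metis
      show ?thesis using form[OF y(1)] form[OF y'(1)] dZS y(2) y'(2) by metis
    qed
    ultimately show "\<exists>R j. echelon_with (q + N) (q + M) j R \<and>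
      (\<forall>X \<in> carrier_mat (q + M) k. top_rows q (R * X) = top_rows q X) \<and>
      (\<forall>X \<in> carrier_mat (q + M) k. \<forall>X' \<in> carrier_mat (q + M) k.
        top_rows q X = top_rows q X' \<longrightarrow> left_invertible (top_rows q X) \<longrightarrow> c (R * X) = c (R * X'))"
      by blast
  qed
qed

text \<open>The preceding lemma for one length of the prefix after another. The matrix that treats length
\<open>q + 1\<close> fixes the first \<open>q + 1\<close> rows, so it preserves what was achieved for shorter prefixes.\<close>

lemma prefix_ramsey:
  "\<exists>n. \<forall>c :: 'a::{field,finite} mat \<Rightarrow> nat. (\<forall>X. c X < r) \<longrightarrow>
    (\<exists>R j. echelon_with n (q + M) j R \<and>
      (\<forall>p X X'. 0 < p \<longrightarrow> p \<le> q \<longrightarrow> X \<in> carrier_mat (q + M) k \<longrightarrow> X' \<in> carrier_mat (q + M) k \<longrightarrow>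
        top_rows p X = top_rows p X' \<longrightarrow> left_invertible (top_rows p X) \<longrightarrow> c (R * X) = c (R * X')))"
proof (induction q arbitrary: M)
  case 0
  show ?case using echelon_with_one[of M] by (intro exI[of _ M]) auto
next
  case (Suc q)
  obtain N where N: "\<And>c :: 'a mat \<Rightarrow> nat. \<forall>X. c X < r \<Longrightarrow>
    (\<exists>R j. echelon_with (Suc q + N) (Suc q + M) j R \<and>
      (\<forall>X \<in> carrier_mat (Suc q + M) k. top_rows (Suc q) (R * X) = top_rows (Suc q) X) \<and>
      (\<forall>X \<in> carrier_mat (Suc q + M) k. \<forall>X' \<in> carrier_mat (Suc q + M) k.
        top_rows (Suc q) X = top_rows (Suc q) X' \<longrightarrow> left_invertible (top_rows (Suc q) X) \<longrightarrow>
        c (R * X) = c (R * X')))"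
    using block_ramsey[of r "Suc q" M k] by blast
  obtain n where n: "\<And>c :: 'a mat \<Rightarrow> nat. \<forall>X. c X < r \<Longrightarrow>
    \<exists>R j. echelon_with n (q + Suc N) j R \<and>
      (\<forall>p X X'. 0 < p \<longrightarrow> p \<le> q \<longrightarrow> X \<in> carrier_mat (q + Suc N) k \<longrightarrow> X' \<in> carrier_mat (q + Suc N) k \<longrightarrow>
        top_rows p X = top_rows p X' \<longrightarrow> left_invertible (top_rows p X) \<longrightarrow> c (R * X) = c (R * X'))"
    using Suc.IH[of "Suc N"] by blast
  show ?case
  proof (intro exI[of _ n] allI impI)
    fix c :: "'a mat \<Rightarrow> nat" assume c: "\<forall>X. c X < r"
    obtain R0 j0 where R0: "echelon_with n (Suc q + N) j0 R0"
      and c0: "\<And>p X X'. 0 < p \<Longrightarrow> p \<le> q \<Longrightarrow> X \<in> carrier_mat (Suc q + N) k \<Longrightarrow> X' \<in> carrier_mat (Suc q + N) k \<Longrightarrow>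
        top_rows p X = top_rows p X' \<Longrightarrow> left_invertible (top_rows p X) \<Longrightarrow> c (R0 * X) = c (R0 * X')"
      using n[OF c] unfolding add_Suc add_Suc_right by blast
    have "\<forall>X. c (R0 * X) < r" using c by simp
    from N[OF this] obtain R1 j1 where R1: "echelon_with (Suc q + N) (Suc q + M) j1 R1"
      and top: "\<And>X. X \<in> carrier_mat (Suc q + M) k \<Longrightarrow> top_rows (Suc q) (R1 * X) = top_rows (Suc q) X"
      and c1: "\<And>X X'. X \<in> carrier_mat (Suc q + M) k \<Longrightarrow> X' \<in> carrier_mat (Suc q + M) k \<Longrightarrow>
        top_rows (Suc q) X = top_rows (Suc q) X' \<Longrightarrow> left_invertible (top_rows (Suc q) X) \<Longrightarrow>
        c (R0 * (R1 * X)) = c (R0 * (R1 * X'))"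
      by blast
    have "c ((R0 * R1) * X) = c ((R0 * R1) * X')"
      if p: "0 < p" "p \<le> Suc q" and X: "X \<in> carrier_mat (Suc q + M) k" "X' \<in> carrier_mat (Suc q + M) k"
        and eq: "top_rows p X = top_rows p X'" and inv: "left_invertible (top_rows p X)" for p X X'
    proof -
      have "c (R0 * (R1 * X)) = c (R0 * (R1 * X'))"
      proof (cases "p = Suc q")
        case True
        show ?thesis by (rule c1[OF X eq[unfolded True] inv[unfolded True]])
      next
        case False
        have t: "top_rows p (R1 * Y) = top_rows p Y" if "Y \<in> carrier_mat (Suc q + M) k" for Y
          using top_rows_cong[OF top[OF that] p(2)] .
        have C: "R1 * Y \<in> carrier_mat (Suc q + N) k" if "Y \<in> carrier_mat (Suc q + M) k" for Y
          using echelon_withD(1)[OF R1] that by simp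
        have "p \<le> q" using False p(2) by simp
        then show ?thesis
          by (intro c0[OF p(1) _ C[OF X(1)] C[OF X(2)]]) (use t X eq inv in metis)+
      qed
      then show ?thesis
        using assoc_mult_mat[OF echelon_withD(1)[OF R0] echelon_withD(1)[OF R1]] X by simp
    qed
    then show "\<exists>R j. echelon_with n (Suc q + M) j R \<and>
      (\<forall>p X X'. 0 < p \<longrightarrow> p \<le> Suc q \<longrightarrow> X \<in> carrier_mat (Suc q + M) k \<longrightarrow> X' \<in> carrier_mat (Suc q + M) k \<longrightarrow>
        top_rows p X = top_rows p X' \<longrightarrow> left_invertible (top_rows p X) \<longrightarrow> c (R * X) = c (R * X'))"
      using echelon_with_mult[OF R0 R1] by blast
  qed
qed

section \<open>Monochromatic echelon matrices\<close>

lemma echelon_with_top_rows: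
  assumes A: "echelon_with n k i A" and "p \<le> n" and "\<And>l. l < k \<Longrightarrow> i l < p"
  shows "echelon_with p k i (top_rows p A)"
proof -
  note D = echelon_withD[OF A]
  have "top_rows p A $$ (i l, b) = (if b = l then 1 else 0)" if "l < k" "b < k" for l b
    using D(1) D(3)[OF that] assms(3)[OF that(1)] that by simp
  moreover have "top_rows p A $$ (a, b) = 0" if "l < k" "a < i l" "b < k" "l \<le> b" for l a b
    using D(1) D(4)[OF that] assms(3)[OF that(1)] that by simp
  ultimately show ?thesis unfolding echelon_with_def using D(1) assms(3) by auto
qed

lemma echelon_with_append_rows:
  assumes A: "echelon_with n k i A" and y: "y \<in> carrier_mat N k"
  shows "echelon_with (n + N) k i (A @\<^sub>r y)"
proof -
  note D = echelon_withD[OF A]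
  have "(A @\<^sub>r y) $$ (a, b) = A $$ (a, b)" if "a < n" "b < k" for a b
    using append_rows_index[OF D(1) y] that by simp
  moreover have "a < n" if "l < k" "a < i l" for a l using D(2)[OF that(1)] that(2) by simp
  ultimately show ?thesis unfolding echelon_with_def
    using D carrier_append_rows[OF D(1) y] by (auto simp: trans_less_add1)
qed

lemma top_rows_echelon_mult:
  assumes R: "echelon_with n m j R" and p: "p < m"
    and A: "A \<in> carrier_mat m k" "A' \<in> carrier_mat m k" and eq: "top_rows p A = top_rows p A'"
  shows "top_rows (j p) (R * A) = top_rows (j p) (R * A')"
proof (rule top_rows_eqI)
  note D = echelon_withD[OF R]
  show "R * A \<in> carrier_mat n k" "R * A' \<in> carrier_mat n k" using D(1) A by auto
  fix a b assume ab: "a < j p" "b < k"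
  then have a: "a < n" using D(2)[OF p] by simp
  have "R $$ (a, l) * A $$ (l, b) = R $$ (a, l) * A' $$ (l, b)" if "l < m" for l
    using D(4)[OF p ab(1) that] top_rows_eqD[OF A eq _ ab(2), of l] by (cases "l < p") auto
  then show "(R * A) $$ (a, b) = (R * A') $$ (a, b)"
    unfolding mat_mult_index[OF D(1) A(1) a ab(2)] mat_mult_index[OF D(1) A(2) a ab(2)]
    by (intro sum.cong) auto
qed

text \<open>The matrices have \<open>Suc k\<close> columns, so \<open>i k\<close> is the row of the last pivot.\<close>

definition prefix_determined :: "('a::field mat \<Rightarrow> 'c) \<Rightarrow> nat \<Rightarrow> nat \<Rightarrow> bool" where
  "prefix_determined c M k \<longleftrightarrow> (\<forall>A A' i i'.
     echelon_with M (Suc k) i A \<longrightarrow> echelon_with M (Suc k) i' A' \<longrightarrow> i k = i' k \<longrightarrow>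
     top_rows (i k) A = top_rows (i k) A' \<longrightarrow> c A = c A')"

lemma echelon_last_pivot_row_cong:
  assumes A: "echelon_with M (Suc k) i A" and A': "echelon_with M (Suc k) i' A'"
    and eq: "i k = i' k" "top_rows (i k) A = top_rows (i k) A'"
  shows "top_rows (Suc (i k)) A = top_rows (Suc (i k)) A'"
proof (rule top_rows_eqI)
  note D = echelon_withD[OF A] and D' = echelon_withD[OF A']
  show "A \<in> carrier_mat M (Suc k)" "A' \<in> carrier_mat M (Suc k)" using D(1) D'(1) .
  fix a b assume "a < Suc (i k)" "b < Suc k"
  then show "A $$ (a, b) = A' $$ (a, b)"
    using D(3)[of k b] D'(3)[of k b] eq(1) top_rows_eqD[OF D(1) D'(1) eq(2), of a b]
    by (cases "a = i k") auto
qed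

text \<open>The rows up to and including the last pivot contain all unit rows, so they have a left inverse
and the colour is independent of the rows below.\<close>

lemma prefix_determined_ramsey:
  "\<exists>n. \<forall>c :: 'a::{field,finite} mat \<Rightarrow> nat. (\<forall>X. c X < r) \<longrightarrow>
    (\<exists>R j. echelon_with n M j R \<and> prefix_determined (\<lambda>X. c (R * X)) M k)"
proof -
  obtain n where n: "\<And>c :: 'a mat \<Rightarrow> nat. \<forall>X. c X < r \<Longrightarrow>
    (\<exists>R j. echelon_with n M j R \<and>
      (\<forall>p X X'. 0 < p \<longrightarrow> p \<le> M \<longrightarrow> X \<in> carrier_mat M (Suc k) \<longrightarrow> X' \<in> carrier_mat M (Suc k) \<longrightarrow>
        top_rows p X = top_rows p X' \<longrightarrow> left_invertible (top_rows p X) \<longrightarrow> c (R * X) = c (R * X')))"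
    using prefix_ramsey[of r M 0 "Suc k"] unfolding add_0_right by blast
  show ?thesis
  proof (intro exI[of _ n] allI impI)
    fix c :: "'a mat \<Rightarrow> nat" assume "\<forall>X. c X < r"
    from n[OF this] obtain R j where R: "echelon_with n M j R"
      and cR: "\<And>p X X'. 0 < p \<Longrightarrow> p \<le> M \<Longrightarrow> X \<in> carrier_mat M (Suc k) \<Longrightarrow> X' \<in> carrier_mat M (Suc k) \<Longrightarrow>
        top_rows p X = top_rows p X' \<Longrightarrow> left_invertible (top_rows p X) \<Longrightarrow> c (R * X) = c (R * X')"
      by blast
    have "prefix_determined (\<lambda>X. c (R * X)) M k"
      unfolding prefix_determined_def
    proof (intro allI impI)
      fix A A' :: "'a mat" and i i'
      assume A: "echelon_with M (Suc k) i A" and A': "echelon_with M (Suc k) i' A'"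
        and eq: "i k = i' k" "top_rows (i k) A = top_rows (i k) A'"
      have le: "Suc (i k) \<le> M" using echelon_withD(2)[OF A, of k] by simp
      have "i l < Suc (i k)" if "l < Suc k" for l
        using echelon_with_pivots_less[OF A, of l k] that by (cases "l = k") auto
      then have "left_invertible (top_rows (Suc (i k)) A)"
        using echelon_with_left_invertible[OF echelon_with_top_rows[OF A le]] by blast
      then show "c (R * A) = c (R * A')"
        using cR[OF _ le echelon_withD(1)[OF A] echelon_withD(1)[OF A']
            echelon_last_pivot_row_cong[OF A A' eq]] by blast
    qed
    with R show "\<exists>R j. echelon_with n M j R \<and> prefix_determined (\<lambda>X. c (R * X)) M k" by blast
  qed
qed

definition adjoin_unit :: "'a::field mat \<Rightarrow> 'a mat" where
  "adjoin_unit A = four_block_mat A (0\<^sub>m (dim_row A) 1) (0\<^sub>m 1 (dim_col A)) (1\<^sub>m 1)"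

lemma adjoin_unit_carrier: "A \<in> carrier_mat n k \<Longrightarrow> adjoin_unit A \<in> carrier_mat (Suc n) (Suc k)"
  unfolding adjoin_unit_def using four_block_carrier_mat[of A n k "1\<^sub>m 1" 1 1] by auto

lemma adjoin_unit_index:
  assumes "A \<in> carrier_mat n k" "a < Suc n" "b < Suc k"
  shows "adjoin_unit A $$ (a, b) =
    (if a < n \<and> b < k then A $$ (a, b) else if a = n \<and> b = k then 1 else 0)"
  using assms unfolding adjoin_unit_def by (subst index_mat_four_block) auto

lemma adjoin_unit_mult:
  assumes A: "A \<in> carrier_mat n m" and B: "B \<in> carrier_mat m k"
  shows "adjoin_unit A * adjoin_unit B = adjoin_unit (A * B)"
proof -
  have "adjoin_unit A * adjoin_unit B =
    four_block_mat (A * B + 0\<^sub>m n 1 * 0\<^sub>m 1 k) (A * 0\<^sub>m m 1 + 0\<^sub>m n 1 * 1\<^sub>m 1)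
      (0\<^sub>m 1 m * B + 1\<^sub>m 1 * 0\<^sub>m 1 k) (0\<^sub>m 1 m * 0\<^sub>m m 1 + 1\<^sub>m 1 * 1\<^sub>m 1)"
    unfolding adjoin_unit_def using assms
    by (subst mult_four_block_mat[of _ n m _ 1 _ 1 _ _ k _ 1]) auto
  then show ?thesis unfolding adjoin_unit_def using assms by simp
qed

lemma adjoin_unit_mult_append_rows:
  assumes A: "A \<in> carrier_mat n m" and B: "B \<in> carrier_mat m k" and w: "w \<in> carrier_mat 1 k"
  shows "adjoin_unit A * (B @\<^sub>r w) = (A * B) @\<^sub>r w"
proof -
  have "adjoin_unit A * (B @\<^sub>r w) =
    four_block_mat (A * B + 0\<^sub>m n 1 * w) (A * 0\<^sub>m m 0 + 0\<^sub>m n 1 * 0\<^sub>m 1 0)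
      (0\<^sub>m 1 m * B + 1\<^sub>m 1 * w) (0\<^sub>m 1 m * 0\<^sub>m m 0 + 1\<^sub>m 1 * 0\<^sub>m 1 0)"
    unfolding adjoin_unit_def append_rows_def using assms
    by (subst mult_four_block_mat[of _ n m _ 1 _ 1 _ _ k _ 0]) auto
  then show ?thesis unfolding append_rows_def using assms by simp
qed

lemma echelon_with_adjoin_unit:
  assumes A: "echelon_with n k i A"
  shows "echelon_with (Suc n) (Suc k) (i(k := n)) (adjoin_unit A)"
proof -
  note D = echelon_withD[OF A]
  have bound: "(i(k := n)) l < Suc n" if "l < Suc k" for l
    using D(2)[of l] that by (cases "l = k") auto
  have "adjoin_unit A $$ ((i(k := n)) l, b) = (if b = l then 1 else 0)" if "l < Suc k" "b < Suc k" for l b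
    using adjoin_unit_index[OF D(1) bound[OF that(1)] that(2)] D(2,3)[of l] that
    by (cases "l = k"; cases "b = k") auto
  moreover have "adjoin_unit A $$ (a, b) = 0"
    if "l < Suc k" "a < (i(k := n)) l" "b < Suc k" "l \<le> b" for l a b
  proof -
    have "a < n" using that(1,2) D(2)[of l] by (cases "l = k") auto
    then show ?thesis
      using adjoin_unit_index[OF D(1) _ that(3), of a] D(4)[of l a b] that
      by (cases "l = k"; cases "b = k") auto
  qed
  ultimately show ?thesis unfolding echelon_with_def
    using bound adjoin_unit_carrier[OF D(1)] by blast
qed

text \<open>If the last pivot is in the last row, removing it leaves an arbitrary echelon matrix with one
column less. This is where the induction on the number of columns enters.\<close>

lemma echelon_last_pivot_in_last_row:
  assumes A: "echelon_with (Suc m) (Suc k) i A" and last: "i k = m"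
  obtains B where "echelon_with m k i B" "A = adjoin_unit B"
proof
  note D = echelon_withD[OF A]
  let ?B = "mat m k (\<lambda>(a, b). A $$ (a, b))"
  have B: "?B \<in> carrier_mat m k" by simp
  have i: "i l < m" if "l < k" for l
    using echelon_with_pivots_less[OF A that] last by simp
  have "a < m" if "l < k" "a < i l" for a l using i[OF that(1)] that(2) by simp
  then show "echelon_with m k i ?B" unfolding echelon_with_def
    using D(3,4) i by auto
  show "A = adjoin_unit ?B"
  proof (rule eq_matI)
    fix a b assume "a < dim_row (adjoin_unit ?B)" "b < dim_col (adjoin_unit ?B)"
    then have ab: "a < Suc m" "b < Suc k" using carrier_matD[OF adjoin_unit_carrier[OF B]] by auto
    show "A $$ (a, b) = adjoin_unit ?B $$ (a, b)"
      using adjoin_unit_index[OF B ab] D(3)[of k b] D(4)[of k a b] ab last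
      by (cases "a = m"; cases "b = k") auto
  qed (use D(1) carrier_matD[OF adjoin_unit_carrier[OF B]] in auto)
qed

definition monochromatic :: "('a::field mat \<Rightarrow> 'c) \<Rightarrow> nat \<Rightarrow> nat \<Rightarrow> bool" where
  "monochromatic c m k \<longleftrightarrow>
    (\<forall>A A' i i'. echelon_with m k i A \<longrightarrow> echelon_with m k i' A' \<longrightarrow> c A = c A')"

definition last_pivot_determined :: "('a::field mat \<Rightarrow> 'c) \<Rightarrow> nat \<Rightarrow> nat \<Rightarrow> bool" where
  "last_pivot_determined c m k \<longleftrightarrow> (\<forall>A A' i i'.
     echelon_with m (Suc k) i A \<longrightarrow> echelon_with m (Suc k) i' A' \<longrightarrow> i k = i' k \<longrightarrow> c A = c A')"

text \<open>Induction on \<open>m\<close>. The matrices with the last pivot in the bottom row are coloured through their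
remaining block, which has \<open>k\<close> columns, and \<open>R1\<close> makes all of them agree. For the others the bottom
row is irrelevant because the colouring is determined by the prefix, so it can be replaced by
zero; multiplying by \<open>R1\<close> and then padding with a zero row pulls the colouring back to another
prefix-determined one, to which the induction hypothesis gives \<open>R2\<close>. Adjoining a unit row and column to \<open>R1 * R2\<close> serves both kinds.\<close>

lemma last_pivot_ramsey:
  assumes IH: "\<And>m. \<exists>n. \<forall>c :: 'a::field mat \<Rightarrow> nat. (\<forall>X. c X < r) \<longrightarrow>
      (\<exists>R j. echelon_with n m j R \<and> monochromatic (\<lambda>A. c (R * A)) m k)"
  shows "\<exists>M. \<forall>c :: 'a mat \<Rightarrow> nat. (\<forall>X. c X < r) \<longrightarrow> prefix_determined c M k \<longrightarrow>
      (\<exists>R j. echelon_with M m j R \<and> last_pivot_determined (\<lambda>A. c (R * A)) m k)"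
proof (induction m)
  case 0
  have "last_pivot_determined c 0 k" for c :: "'a mat \<Rightarrow> nat"
    unfolding last_pivot_determined_def using echelon_withD(2) by blast
  then show ?case using echelon_with_one[of 0] by blast
next
  case (Suc m)
  obtain M where M: "\<And>c :: 'a mat \<Rightarrow> nat. \<forall>X. c X < r \<Longrightarrow> prefix_determined c M k \<Longrightarrow>
      \<exists>R j. echelon_with M m j R \<and> last_pivot_determined (\<lambda>A. c (R * A)) m k"
    using Suc.IH by blast
  obtain n where n: "\<And>c :: 'a mat \<Rightarrow> nat. \<forall>X. c X < r \<Longrightarrow>
      \<exists>R j. echelon_with n M j R \<and> monochromatic (\<lambda>A. c (R * A)) M k"
    using IH[of M] by blast
  show ?case
  proof (intro exI[of _ "Suc n"] allI impI)
    fix c :: "'a mat \<Rightarrow> nat" assume c: "\<forall>X. c X < r" and det: "prefix_determined c (Suc n) k"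
    have "\<forall>X. c (adjoin_unit X) < r" using c by simp
    from n[OF this] obtain R1 j1 where R1: "echelon_with n M j1 R1"
      and mono1: "monochromatic (\<lambda>A. c (adjoin_unit (R1 * A))) M k" by blast
    let ?z = "0\<^sub>m 1 (Suc k) :: 'a mat"
    let ?d = "\<lambda>A. c ((R1 * A) @\<^sub>r ?z)"
    have z: "?z \<in> carrier_mat 1 (Suc k)" by simp
    have ech_pad: "echelon_with (Suc n) (Suc k) (\<lambda>b. j1 (i b)) ((R1 * A) @\<^sub>r y)"
      if "echelon_with M (Suc k) i A" "y \<in> carrier_mat 1 (Suc k)" for i A y
      using echelon_with_append_rows[OF echelon_with_mult[OF R1 that(1)] that(2)] by simp
    have pad: "c ((R1 * A) @\<^sub>r y) = c ((R1 * A') @\<^sub>r y')"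
      if A: "echelon_with M (Suc k) i A" "echelon_with M (Suc k) i' A'"
        and eq: "i k = i' k" "top_rows (i k) A = top_rows (i k) A'"
        and y: "y \<in> carrier_mat 1 (Suc k)" "y' \<in> carrier_mat 1 (Suc k)" for A A' i i' y y'
    proof -
      have p: "i k < M" using echelon_withD(2)[OF A(1)] by simp
      have le: "j1 (i k) \<le> n" using echelon_withD(2)[OF R1 p] by simp
      have C: "R1 * A \<in> carrier_mat n (Suc k)" "R1 * A' \<in> carrier_mat n (Suc k)"
        using echelon_withD(1)[OF R1] echelon_withD(1)[OF A(1)] echelon_withD(1)[OF A(2)] by auto
      have drop: "top_rows (j1 (i k)) (X @\<^sub>r w) = top_rows (j1 (i k)) X"
        if "X \<in> carrier_mat n (Suc k)" "w \<in> carrier_mat 1 (Suc k)" for X w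
        using top_rows_cong[OF _ le] top_rows_append[OF that] top_rows_top_rows[OF le] by metis
      have "top_rows (j1 (i k)) (R1 * A) = top_rows (j1 (i k)) (R1 * A')"
        by (rule top_rows_echelon_mult[OF R1 p echelon_withD(1)[OF A(1)] echelon_withD(1)[OF A(2)] eq(2)])
      then have top: "top_rows (j1 (i k)) ((R1 * A) @\<^sub>r y) = top_rows (j1 (i k)) ((R1 * A') @\<^sub>r y')"
        unfolding drop[OF C(1) y(1)] drop[OF C(2) y(2)] .
      have "j1 (i k) = j1 (i' k)" using eq(1) by simp
      from det[unfolded prefix_determined_def, rule_format,
          OF ech_pad[OF A(1) y(1)] ech_pad[OF A(2) y(2)] this top]
      show ?thesis .
    qed
    have "prefix_determined ?d M k"
      unfolding prefix_determined_def using pad z by blast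
    moreover have "\<forall>X. ?d X < r" using c by simp
    ultimately obtain R2 j2 where R2: "echelon_with M m j2 R2"
      and lp2: "last_pivot_determined (\<lambda>A. ?d (R2 * A)) m k"
      using M[of ?d] by blast
    note C1 = echelon_withD(1)[OF R1] and C2 = echelon_withD(1)[OF R2]
    let ?R = "adjoin_unit (R1 * R2)"
    have R: "echelon_with (Suc n) (Suc m) ((\<lambda>b. j1 (j2 b))(m := n)) ?R"
      by (rule echelon_with_adjoin_unit[OF echelon_with_mult[OF R1 R2]])
    have C12: "R1 * R2 \<in> carrier_mat n m" using C1 C2 by simp
    have "c (?R * A) = c (?R * A')"
      if A: "echelon_with (Suc m) (Suc k) i A" and A': "echelon_with (Suc m) (Suc k) i' A'"
        and eq: "i k = i' k" for A A' i i'
    proof (cases "i k = m")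
      case True
      have form: "\<exists>B i. echelon_with M k i B \<and> ?R * A = adjoin_unit (R1 * B)"
        if A: "echelon_with (Suc m) (Suc k) i A" and last: "i k = m" for A i
      proof -
        obtain B where B: "echelon_with m k i B" "A = adjoin_unit B"
          using echelon_last_pivot_in_last_row[OF A last] .
        note CB = echelon_withD(1)[OF B(1)]
        have "?R * A = adjoin_unit (R1 * (R2 * B))"
          unfolding B(2) adjoin_unit_mult[OF C12 CB] assoc_mult_mat[OF C1 C2 CB] ..
        then show ?thesis using echelon_with_mult[OF R2 B(1)] by blast
      qed
      show ?thesis
        using form[OF A True] form[OF A'] True eq mono1 unfolding monochromatic_def by metis
    next
      case False
      have form: "\<exists>B. echelon_with m (Suc k) i B \<and> c (?R * A) = ?d (R2 * B)"
        if A: "echelon_with (Suc m) (Suc k) i A" and last: "i k \<noteq> m" for A i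
      proof -
        have ik: "i k < m" using echelon_withD(2)[OF A, of k] last by simp
        have "i l < m" if "l < Suc k" for l
          using echelon_with_pivots_less[OF A, of l k] that ik by (cases "l = k") auto
        then have B: "echelon_with m (Suc k) i (top_rows m A)"
          using echelon_with_top_rows[OF A, of m] by simp
        note CB = echelon_withD(1)[OF B]
        obtain w where w: "w \<in> carrier_mat 1 (Suc k)" "A = top_rows m A @\<^sub>r w"
          using split_top_rows[of A m 1] echelon_withD(1)[OF A] by auto
        have "?R * A = (R1 * (R2 * top_rows m A)) @\<^sub>r w"
          using adjoin_unit_mult_append_rows[OF C12 CB w(1)] assoc_mult_mat[OF C1 C2 CB] w(2) by simp
        then have "c (?R * A) = ?d (R2 * top_rows m A)"
          using pad[OF echelon_with_mult[OF R2 B] echelon_with_mult[OF R2 B] refl refl w(1) z] by simp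
        then show ?thesis using B by blast
      qed
      show ?thesis
        using form[OF A False] form[OF A'] False eq lp2 unfolding last_pivot_determined_def by metis
    qed
    then show "\<exists>R j. echelon_with (Suc n) (Suc m) j R \<and> last_pivot_determined (\<lambda>A. c (R * A)) (Suc m) k"
      using R unfolding last_pivot_determined_def by blast
  qed
qed

lemma echelon_with_selection:
  assumes f: "\<And>b. b < m \<Longrightarrow> f b < n" and mono: "\<And>a b. a < b \<Longrightarrow> b < m \<Longrightarrow> f a < f b"
  shows "echelon_with n m f (mat n m (\<lambda>(a, b). if a = f b then 1 else 0))"
proof -
  have inj: "f a = f b \<longleftrightarrow> a = b" if "a < m" "b < m" for a b
    using mono[of a b] mono[of b a] that by (cases a b rule: linorder_cases) auto
  have le: "f a \<le> f b" if "a \<le> b" "b < m" for a b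
    using mono[of a b] that by (cases "a = b") auto
  have "a < n" if "b < m" "a < f b" for a b using f[OF that(1)] that(2) by simp
  then show ?thesis unfolding echelon_with_def using f inj le by (auto simp: leD)
qed

lemma pigeonhole_increasing:
  fixes e :: "nat \<Rightarrow> nat"
  assumes e: "\<And>q. e q < r" and m: "0 < m"
  obtains f x where "\<And>b. b < m \<Longrightarrow> f b < m * r" "\<And>a b. a < b \<Longrightarrow> b < m \<Longrightarrow> f a < f b"
    "\<And>b. b < m \<Longrightarrow> e (f b) = x"
proof -
  have "\<exists>x<r. m \<le> card {q \<in> {..<m * r}. e q = x}"
  proof (rule ccontr)
    assume "\<not> ?thesis"
    then have less: "card {q \<in> {..<m * r}. e q = x} \<le> m - 1" if "x < r" for x
      using that by (metis Suc_pred' less_Suc_eq_le m not_le)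
    have "{..<m * r} = (\<Union>x<r. {q \<in> {..<m * r}. e q = x})" using e by auto
    then have "m * r = card (\<Union>x<r. {q \<in> {..<m * r}. e q = x})" by (metis card_lessThan)
    also have "\<dots> \<le> (\<Sum>x<r. card {q \<in> {..<m * r}. e q = x})" by (rule card_UN_le) simp
    also have "\<dots> \<le> (\<Sum>x<r. m - 1)" by (rule sum_mono) (use less in auto)
    finally have "m * r \<le> r * (m - 1)" by simp
    moreover have "0 < r" using e[of 0] by simp
    ultimately show False using m by (simp add: mult.commute)
  qed
  then obtain x where x: "m \<le> card {q \<in> {..<m * r}. e q = x}" by blast
  let ?K = "{q \<in> {..<m * r}. e q = x}"
  let ?l = "sorted_list_of_set ?K"
  have fin: "finite ?K" by simp
  have len: "m \<le> length ?l" using x by simp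
  have set: "set ?l = ?K" using fin by simp
  have mem: "?l ! b \<in> ?K" if "b < m" for b
    using nth_mem[of b ?l] that len set by auto
  show ?thesis
  proof (rule that[of "\<lambda>b. ?l ! b" x])
    show "?l ! a < ?l ! b" if "a < b" "b < m" for a b
      by (rule sorted_wrt_nth_less[OF strict_sorted_list_of_set that(1)]) (use that len in linarith)
  qed (use mem in auto)
qed

text \<open>This is the Graham--Leeb--Rothschild theorem: the columns of \<open>R\<close> span an \<open>m\<close>-dimensional space, and the
matrices \<open>R * A\<close> are the reduced bases of its \<open>k\<close>-dimensional subspaces. Induction on \<open>k\<close>. After the
two reductions the colour depends only on the position of the last pivot among \<open>m * r\<close> rows; by the
pigeonhole principle \<open>m\<close> of these positions share a colour, and a selection matrix moves all pivots
into them.\<close>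

theorem echelon_ramsey:
  "\<exists>n. \<forall>c :: 'a::{field,finite} mat \<Rightarrow> nat. (\<forall>X. c X < r) \<longrightarrow>
      (\<exists>R j. echelon_with n m j R \<and> monochromatic (\<lambda>A. c (R * A)) m k)"
proof (induction k arbitrary: m)
  case 0
  have "monochromatic c m 0" for c :: "'a mat \<Rightarrow> nat"
    unfolding monochromatic_def
  proof (intro allI impI)
    fix A A' :: "'a mat" and i i' assume "echelon_with m 0 i A" "echelon_with m 0 i' A'"
    then have "A \<in> carrier_mat m 0" "A' \<in> carrier_mat m 0" using echelon_withD(1) by auto
    then have "A = A'" by (intro eq_matI) auto
    then show "c A = c A'" by simp
  qed
  then show ?case using echelon_with_one[of m] by blast
next
  case (Suc k)
  show ?case
  proof (cases "m = 0")
    case True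
    have "monochromatic c 0 (Suc k)" for c :: "'a mat \<Rightarrow> nat"
      unfolding monochromatic_def using echelon_withD(2) by blast
    then show ?thesis using echelon_with_one[of 0] True by blast
  next
    case False
    obtain M where M: "\<And>c :: 'a mat \<Rightarrow> nat. \<forall>X. c X < r \<Longrightarrow> prefix_determined c M k \<Longrightarrow>
        \<exists>R j. echelon_with M (m * r) j R \<and> last_pivot_determined (\<lambda>A. c (R * A)) (m * r) k"
      using last_pivot_ramsey[OF Suc.IH, of "m * r"] by blast
    obtain n where n: "\<And>c :: 'a mat \<Rightarrow> nat. \<forall>X. c X < r \<Longrightarrow>
        \<exists>R j. echelon_with n M j R \<and> prefix_determined (\<lambda>X. c (R * X)) M k"
      using prefix_determined_ramsey[of r M k] by blast
    show ?thesis
    proof (intro exI[of _ n] allI impI)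
      fix c :: "'a mat \<Rightarrow> nat" assume c: "\<forall>X. c X < r"
      obtain R1 j1 where R1: "echelon_with n M j1 R1" "prefix_determined (\<lambda>X. c (R1 * X)) M k"
        using n[OF c] by blast
      have "\<forall>X. c (R1 * X) < r" using c by simp
      from M[OF this R1(2)] obtain R2 j2 where R2: "echelon_with M (m * r) j2 R2"
        and lp: "last_pivot_determined (\<lambda>A. c (R1 * (R2 * A))) (m * r) k" by blast
      \<comment> \<open>The colour of every echelon matrix with last pivot q; an arbitrary colour if there is none.\<close>
      define e where "e q = c (R1 * (R2 * (SOME A. \<exists>i. echelon_with (m * r) (Suc k) i A \<and> i k = q)))" for q
      have e: "c (R1 * (R2 * A)) = e (i k)" if A: "echelon_with (m * r) (Suc k) i A" for A i
      proof -
        have "\<exists>(A :: 'a mat) i'. echelon_with (m * r) (Suc k) i' A \<and> i' k = i k" using A by blast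
        from someI_ex[OF this] obtain i' where
          i': "echelon_with (m * r) (Suc k) i'
            (SOME A :: 'a mat. \<exists>i'. echelon_with (m * r) (Suc k) i' A \<and> i' k = i k)" "i' k = i k"
          by (elim exE conjE)
        from lp[unfolded last_pivot_determined_def, rule_format, OF A i'(1) i'(2)[symmetric]] show ?thesis
          unfolding e_def .
      qed
      have er: "e q < r" for q unfolding e_def using c by simp
      have "0 < m" using False by simp
      from pigeonhole_increasing[of e, OF er this] obtain f x where
        f: "\<And>b. b < m \<Longrightarrow> f b < m * r" "\<And>a b. a < b \<Longrightarrow> b < m \<Longrightarrow> f a < f b"
        and x: "\<And>b. b < m \<Longrightarrow> e (f b) = x" by blast
      define S :: "'a mat" where "S = mat (m * r) m (\<lambda>(a, b). if a = f b then 1 else 0)"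
      have S: "echelon_with (m * r) m f S" unfolding S_def using echelon_with_selection[of m f "m * r"] f by blast
      let ?R = "R1 * (R2 * S)"
      have "c (?R * A) = x" if A: "echelon_with m (Suc k) i A" for A i
      proof -
        note CA = echelon_withD(1)[OF A] and CS = echelon_withD(1)[OF S]
          and C2 = echelon_withD(1)[OF R2] and C1 = echelon_withD(1)[OF R1(1)]
        have "?R * A = R1 * ((R2 * S) * A)" using C1 C2 CS CA by (intro assoc_mult_mat) auto
        also have "(R2 * S) * A = R2 * (S * A)" by (rule assoc_mult_mat[OF C2 CS CA])
        finally have "c (?R * A) = e (f (i k))" using e[OF echelon_with_mult[OF S A]] by simp
        then show ?thesis using x echelon_withD(2)[OF A, of k] by simp
      qed
      then have "monochromatic (\<lambda>A. c (?R * A)) m (Suc k)" unfolding monochromatic_def by metis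
      then show "\<exists>R j. echelon_with n m j R \<and> monochromatic (\<lambda>A. c (R * A)) m (Suc k)"
        using echelon_with_mult[OF R1(1) echelon_with_mult[OF R2 S]] by blast
    qed
  qed
qed

lemma echelon_ramsey_finite_colours:
  assumes C: "finite C"
  shows "\<exists>n. \<forall>c :: 'a::{field,finite} mat \<Rightarrow> 'c. (\<forall>X. c X \<in> C) \<longrightarrow>
      (\<exists>R j. echelon_with n m j R \<and> monochromatic (\<lambda>A. c (R * A)) m k)"
proof -
  obtain h :: "'c \<Rightarrow> nat" and r where h: "h ` C = {i. i < r}" "inj_on h C"
    using finite_imp_inj_to_nat_seg[OF C] by metis
  obtain n where n: "\<And>c :: 'a mat \<Rightarrow> nat. \<forall>X. c X < r \<Longrightarrow>
      \<exists>R j. echelon_with n m j R \<and> monochromatic (\<lambda>A. c (R * A)) m k"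
    using echelon_ramsey[of r m k] by blast
  show ?thesis
  proof (intro exI[of _ n] allI impI)
    fix c :: "'a mat \<Rightarrow> 'c" assume c: "\<forall>X. c X \<in> C"
    then have "\<forall>X. h (c X) < r" using h(1) by blast
    from n[OF this] obtain R j where R: "echelon_with n m j R"
      and mono: "monochromatic (\<lambda>A. h (c (R * A))) m k" by blast
    have "monochromatic (\<lambda>A. c (R * A)) m k"
      using mono c h(2) unfolding monochromatic_def inj_on_def by blast
    with R show "\<exists>R j. echelon_with n m j R \<and> monochromatic (\<lambda>A. c (R * A)) m k" by blast
  qed
qed

lemma echelon_mult_rank_mats:
  assumes R: "echelon_with n m j R" and A: "A \<in> rank_mats m k k"
  shows "R * A \<in> rank_mats n k k"
proof -
  note C = echelon_withD(1)[OF R]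
  have A': "A \<in> carrier_mat m k" "left_invertible A" using A unfolding rank_mats_full by auto
  show ?thesis
    using left_invertible_mult[OF C echelon_with_left_invertible[OF R] A']
      mult_carrier_mat[OF C A'(1)] unfolding rank_mats_full by blast
qed

text \<open>Every matrix of rank \<open>k\<close> is \<open>B * G\<close> with \<open>B\<close> in echelon form and \<open>G\<close> the inverse of its \<open>tau\<close>.
Colouring \<open>B\<close> by the function \<open>G \<mapsto> c (B * G)\<close> and applying the theorem for echelon matrices makes the
colour of \<open>R * B * G\<close> depend on \<open>G\<close> alone.\<close>

theorem theorem1p7:
  fixes k m r :: nat
  shows "\<exists>n. \<forall>c \<in> (rank_mats n k k :: 'a::{field,finite} mat set) \<rightarrow> {..<r}.
    \<exists>R \<in> rcef_mats n m.
      is_factor_in (rank_mats n k k) (GL_mats k) r tau c ((\<lambda>A. R * A) ` rank_mats m k k)"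
proof (cases "r = 0")
  case True
  \<comment> \<open>With no colours, n is chosen so that there is a matrix to be coloured, and hence no colouring.\<close>
  have "1\<^sub>m k \<in> (rank_mats k k k :: 'a mat set)"
    using echelon_with_rank_mats[OF echelon_with_one] .
  then show ?thesis using True by (intro exI[of _ k]) (auto simp: Pi_def)
next
  case False
  let ?GL = "GL_mats k :: 'a mat set"
  let ?C = "?GL \<rightarrow>\<^sub>E {..<r}"
  have "finite ?GL" using finite_carrier_mat finite_subset[of ?GL "carrier_mat k k"]
    unfolding GL_mats_def by blast
  then have "finite ?C" by (intro finite_PiE) auto
  from echelon_ramsey_finite_colours[OF this, of m k]
  obtain n where n: "\<And>d :: 'a mat \<Rightarrow> 'a mat \<Rightarrow> nat. \<forall>X. d X \<in> ?C \<Longrightarrow>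
      \<exists>R j. echelon_with n m j R \<and> monochromatic (\<lambda>A. d (R * A)) m k" by blast
  have "\<exists>R \<in> rcef_mats n m.
      is_factor_in (rank_mats n k k) ?GL r tau c ((\<lambda>A. R * A) ` rank_mats m k k)"
    if c: "c \<in> rank_mats n k k \<rightarrow> {..<r}" for c
  proof -
    \<comment> \<open>The value 0 only makes the colouring total; B * G has full rank whenever B is an echelon matrix.\<close>
    define d where "d B = restrict (\<lambda>G. if B * G \<in> rank_mats n k k then c (B * G) else 0) ?GL" for B
    have "\<forall>X. d X \<in> ?C" unfolding d_def using c False by auto
    from n[OF this] obtain R j where R: "echelon_with n m j R"
      and mono: "monochromatic (\<lambda>A. d (R * A)) m k" by blast
    have form: "\<exists>B i. echelon_with m k i B \<and> c (R * A) = d (R * B) G"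
      if A: "A \<in> rank_mats m k k" and G: "G \<in> GL_mats k" "tau A * G = 1\<^sub>m k" for A G
    proof -
      obtain i where i: "tau A \<in> GL_mats k" "echelon_with m k i (A * tau A)" using tau_rank_mats[OF A] .
      have C: "A \<in> carrier_mat m k" "tau A \<in> carrier_mat k k" "G \<in> carrier_mat k k"
        using A i(1) G(1) unfolding rank_mats_def GL_mats_def by auto
      have AG: "(A * tau A) * G = A" using assoc_mult_mat[OF C] C G(2) by simp
      have "(R * (A * tau A)) * G = R * A"
        using assoc_mult_mat[OF echelon_withD(1)[OF R] echelon_withD(1)[OF i(2)] C(3)] AG by simp
      then have "d (R * (A * tau A)) G = c (R * A)"
        unfolding d_def using G(1) echelon_mult_rank_mats[OF R A] by simp
      then show ?thesis using i(2) by metis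
    qed
    have factor: "c (R * A) = c (R * A')"
      if A: "A \<in> rank_mats m k k" "A' \<in> rank_mats m k k" and eq: "tau (R * A) = tau (R * A')" for A A'
    proof -
      have t: "tau A = tau A'" using tau_echelon_mult[OF R A(1)] tau_echelon_mult[OF R A(2)] eq by simp
      obtain G where G: "G \<in> GL_mats k" "tau A * G = 1\<^sub>m k"
        using tau_rank_mats[OF A(1)] GL_mats_inverse by metis
      obtain B i where B: "echelon_with m k i B" "c (R * A) = d (R * B) G"
        using form[OF A(1) G] by blast
      obtain B' i' where B': "echelon_with m k i' B'" "c (R * A') = d (R * B') G"
        using form[OF A(2)] G t by metis
      show ?thesis using mono B B' unfolding monochromatic_def by metis
    qed
    let ?Y = "(\<lambda>A. R * A) ` rank_mats m k k"
    define c' where "c' T = (if \<exists>y\<in>?Y. tau y = T then c (SOME y. y \<in> ?Y \<and> tau y = T) else 0)" for T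
    have Y: "?Y \<subseteq> rank_mats n k k" using echelon_mult_rank_mats[OF R] by blast
    have some: "(SOME y'. y' \<in> ?Y \<and> tau y' = tau y) \<in> ?Y \<and> tau (SOME y'. y' \<in> ?Y \<and> tau y' = tau y) = tau y"
      if "y \<in> ?Y" for y
      by (rule someI[of "\<lambda>y'. y' \<in> ?Y \<and> tau y' = tau y" y]) (use that in simp)
    have c'y: "c y = c' (tau y)" if y: "y \<in> ?Y" for y
    proof -
      have "c' (tau y) = c (SOME y'. y' \<in> ?Y \<and> tau y' = tau y)" unfolding c'_def using y by auto
      also have "\<dots> = c y"
      proof -
        obtain A where A: "A \<in> rank_mats m k k" "y = R * A" using y by blast
        obtain A' where A': "A' \<in> rank_mats m k k" "(SOME y'. y' \<in> ?Y \<and> tau y' = tau y) = R * A'"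
          using conjunct1[OF some[OF y]] by (rule imageE)
        have "tau (R * A') = tau (R * A)" using conjunct2[OF some[OF y]] unfolding A'(2) A(2)[symmetric] .
        from factor[OF A'(1) A(1) this] show ?thesis unfolding A'(2) A(2)[symmetric] .
      qed
      finally show ?thesis ..
    qed
    have "c' T < r" for T
    proof (cases "\<exists>y\<in>?Y. tau y = T")
      case True
      then obtain y where "y \<in> ?Y" "tau y = T" by blast
      then have "c' T = c y" "y \<in> rank_mats n k k" using c'y Y by auto
      then show ?thesis using c by auto
    next
      case no: False
      then show ?thesis unfolding c'_def if_not_P[OF no] using False by simp
    qed
    then have "c' \<in> ?GL \<rightarrow> {..<r}" by simp
    moreover have "tau \<in> rank_mats n k k \<rightarrow> ?GL" using tau_rank_mats by blast
    ultimately have "is_factor_in (rank_mats n k k) ?GL r tau c ?Y"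
      unfolding is_factor_in_def using c Y c'y by blast
    moreover have "R \<in> rcef_mats n m" using R rcef_mats_iff_echelon by blast
    ultimately show ?thesis by blast
  qed
  then show ?thesis by blast
qed

end
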